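(* Assume $\mathcal O$ is finite and set $\omega=\frac{1}{|\mathcal O|}\sum_{a\in\mathcal O}a$. For a family $p=(p_a)_{a\in\mathcal O}$ of $1$-chains set $\gamma_x(p)=-\frac{1}{|\mathcal O|}\sum_{a\in\mathcal O}\partial^y(p_a)$ and $\gamma_y(p)=-\frac{1}{|\mathcal O|}\sum_{a\in\mathcal O}\partial^x(p_a)$. Let $p^x=(p^x_a)_{a\in\mathcal O}$ and $p^y=(p^y_a)_{a\in\mathcal O}$ be two families of $1$-chains such that for every $a\in\mathcal O$, $\varepsilon^x(\partial(p^x_a)+(x,y)-a)=0$ and $\varepsilon^y(\partial(p^y_a)+(x,y)-a)=0$. Then $(\omega+\gamma_x(p^x),\gamma_y(p^y))$ is a pseudo-decoupling of $(x,y)$.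
   Context: Fix a finite set $\mathcal S\subset\mathbb Z^2$ and nonzero complex weights; step polynomial $S(X,Y)=\sum_{(i,j)\in\mathcal S}w_{(i,j)}X^iY^j$ with smallest/largest exponents $-m_x,M_x$ in $X$ and $-m_y,M_y$ in $Y$, all positive; kernel $\widetilde K(X,Y,t)=X^{m_x}Y^{m_y}(1-tS(X,Y))$. Let $x,y$ be algebraically independent over $\mathbb C$, $k=\mathbb C(S(x,y))$, $\mathbb K$ an algebraic closure of $\mathbb C(x,y)$. Write $(u,v)\sim^x(u',v')$ if $u=u'$ and $S(u,v)=S(u',v')$, $(u,v)\sim^y(u',v')$ if $v=v'$ and $S(u,v)=S(u',v')$; the orbit $\mathcal O$ is the class of $(x,y)$ under the equivalence relation they generate. Graph structure: vertices $\mathcal O$, x-edges between distinct $\sim^x$-related vertices, y-edges between distinct $\sim^y$-related vertices, with a fixed orientation. $0$-chains: $\mathbb C$-linear combinations of vertices; $1$-chains: $\mathbb C$-linear combinations of arcs, with $(a,a')$ denoting the arc or minus its reverse. $\partial(a,a')=a'-a$; $\partial^x$ (resp. $\partial^y$) is linear, equal to $\partial$ on x-arcs (resp. y-arcs) and $0$ on the other arcs. For a $0$-chain $\beta=\sum\lambda_a a$, $\varepsilon^x(\beta)=0$ means $\sum_{v}\lambda_{(u,v)}=0$ for every $u$, and $\varepsilon^y(\beta)=0$ means $\sum_u\lambda_{(u,v)}=0$ for every $v$. A fraction $H=A/B$ ($A,B$ coprime in $\mathbb C[X,Y,t]$) is regular if $\widetilde K\nmid B$; $H_{(u,v)}=H(u,v,1/S(x,y))$,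 extended linearly to $0$-chains. $H$ admits a Galois decoupling if $H=F+E+\widetilde KR$ with $F\in\mathbb C(X,t)$, $E\in\mathbb C(Y,t)$, $R$ regular. A pair $(\gamma_x,\gamma_y)$ of $0$-chains is a pseudo-decoupling of $(x,y)$ if for every regular $H$ admitting a Galois decoupling, $H_{(x,y)}=H_{\gamma_x}+H_{\gamma_y}$ with $H_{\gamma_x}\in k(x)$ and $H_{\gamma_y}\in k(y)$. *)

theory Defs
  imports
    "HOL-Computational_Algebra.Computational_Algebra"
    "HOL-Computational_Algebra.Field_as_Ring"
    "HOL-Library.Poly_Mapping"
begin

(* The polynomial ring C[X,Y,t] is complex poly poly poly: the innermost variable is X,
   the middle one Y, the outermost one t.  C(X,Y,t) is its fraction field.
   Throughout, \<iota> is the embedding of C into the field K and points of K x K are pairs (u,v). *)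

type_synonym poly_XY = "complex poly poly"
type_synonym poly_XYt = "complex poly poly poly"
type_synonym frac_XYt = "complex poly poly poly fract"

definition field_embedding :: "(complex \<Rightarrow> 'k::field) \<Rightarrow> bool" where
  "field_embedding \<iota> \<longleftrightarrow>
     \<iota> 1 = 1 \<and> (\<forall>a b. \<iota> (a + b) = \<iota> a + \<iota> b) \<and> (\<forall>a b. \<iota> (a * b) = \<iota> a * \<iota> b)"

definition eval_XY :: "(complex \<Rightarrow> 'k::field) \<Rightarrow> poly_XY \<Rightarrow> 'k \<Rightarrow> 'k \<Rightarrow> 'k" where
  "eval_XY \<iota> P u v = poly (map_poly (\<lambda>q. poly (map_poly \<iota> q) u) P) v"

definition eval_XYt :: "(complex \<Rightarrow> 'k::field) \<Rightarrow> poly_XYt \<Rightarrow> 'k \<Rightarrow> 'k \<Rightarrow> 'k \<Rightarrow> 'k" where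
  "eval_XYt \<iota> P u v s = poly (map_poly (\<lambda>Q. eval_XY \<iota> Q u v) P) s"

definition alg_indep2 :: "(complex \<Rightarrow> 'k::field) \<Rightarrow> 'k \<Rightarrow> 'k \<Rightarrow> bool" where
  "alg_indep2 \<iota> x y \<longleftrightarrow> (\<forall>P. P \<noteq> 0 \<longrightarrow> eval_XY \<iota> P x y \<noteq> 0)"

inductive_set gen_subfield :: "'k::field set \<Rightarrow> 'k set" for A where
  base: "a \<in> A \<Longrightarrow> a \<in> gen_subfield A"
| one: "1 \<in> gen_subfield A"
| diff: "a \<in> gen_subfield A \<Longrightarrow> b \<in> gen_subfield A \<Longrightarrow> a - b \<in> gen_subfield A"
| mult: "a \<in> gen_subfield A \<Longrightarrow> b \<in> gen_subfield A \<Longrightarrow> a * b \<in> gen_subfield A"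
| inverse: "a \<in> gen_subfield A \<Longrightarrow> inverse a \<in> gen_subfield A"

definition algebraic_over_subfield :: "'k::field set \<Rightarrow> 'k \<Rightarrow> bool" where
  "algebraic_over_subfield L z \<longleftrightarrow> (\<exists>p. p \<noteq> 0 \<and> (\<forall>i. coeff p i \<in> L) \<and> poly p z = 0)"

(* The type 'k is algebraically closed by its type class; together with this condition
   it is an algebraic closure of C(x,y). *)
definition algebraic_over_Cxy :: "(complex \<Rightarrow> 'k::alg_closed_field) \<Rightarrow> 'k \<Rightarrow> 'k \<Rightarrow> bool" where
  "algebraic_over_Cxy \<iota> x y \<longleftrightarrow>
     (\<forall>z. algebraic_over_subfield (gen_subfield (range \<iota> \<union> {x, y})) z)"

definition m_x :: "(int \<times> int) set \<Rightarrow> int" where "m_x \<S> = - Min (fst ` \<S>)"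
definition M_x :: "(int \<times> int) set \<Rightarrow> int" where "M_x \<S> = Max (fst ` \<S>)"
definition m_y :: "(int \<times> int) set \<Rightarrow> int" where "m_y \<S> = - Min (snd ` \<S>)"
definition M_y :: "(int \<times> int) set \<Rightarrow> int" where "M_y \<S> = Max (snd ` \<S>)"

(* Meaningful for u, v nonzero only, since negative exponents occur. *)
definition step_value ::
  "(int \<times> int) set \<Rightarrow> (int \<times> int \<Rightarrow> complex) \<Rightarrow> (complex \<Rightarrow> 'k::field) \<Rightarrow> 'k \<Rightarrow> 'k \<Rightarrow> 'k" where
  "step_value \<S> w \<iota> u v = (\<Sum>(i, j)\<in>\<S>. \<iota> (w (i, j)) * u powi i * v powi j)"

(* X^m_x Y^m_y (1 - t S(X,Y)), with the monomial multiplied into the Laurent polynomial S: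
   the coefficient of t^0 is X^m_x Y^m_y, that of t^1 is - X^m_x Y^m_y S(X,Y). *)
definition kernel_poly :: "(int \<times> int) set \<Rightarrow> (int \<times> int \<Rightarrow> complex) \<Rightarrow> poly_XYt" where
  "kernel_poly \<S> w =
     [: monom (monom 1 (nat (m_x \<S>))) (nat (m_y \<S>)),
        - (\<Sum>(i, j)\<in>\<S>. monom (monom (w (i, j)) (nat (i + m_x \<S>))) (nat (j + m_y \<S>))) :]"

(* S(u,v) only makes sense for nonzero u and v, so both points are required to have
   nonzero coordinates. *)
definition sim_x ::
  "(int \<times> int) set \<Rightarrow> (int \<times> int \<Rightarrow> complex) \<Rightarrow> (complex \<Rightarrow> 'k::field) \<Rightarrow> 'k \<times> 'k \<Rightarrow> 'k \<times> 'k \<Rightarrow> bool"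
  where
  "sim_x \<S> w \<iota> = (\<lambda>(u, v) (u', v').
     u \<noteq> 0 \<and> v \<noteq> 0 \<and> u' \<noteq> 0 \<and> v' \<noteq> 0 \<and>
     u = u' \<and> step_value \<S> w \<iota> u v = step_value \<S> w \<iota> u' v')"

definition sim_y ::
  "(int \<times> int) set \<Rightarrow> (int \<times> int \<Rightarrow> complex) \<Rightarrow> (complex \<Rightarrow> 'k::field) \<Rightarrow> 'k \<times> 'k \<Rightarrow> 'k \<times> 'k \<Rightarrow> bool"
  where
  "sim_y \<S> w \<iota> = (\<lambda>(u, v) (u', v').
     u \<noteq> 0 \<and> v \<noteq> 0 \<and> u' \<noteq> 0 \<and> v' \<noteq> 0 \<and>
     v = v' \<and> step_value \<S> w \<iota> u v = step_value \<S> w \<iota> u' v')"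

definition orbit ::
  "(int \<times> int) set \<Rightarrow> (int \<times> int \<Rightarrow> complex) \<Rightarrow> (complex \<Rightarrow> 'k::field) \<Rightarrow> 'k \<Rightarrow> 'k \<Rightarrow> ('k \<times> 'k) set"
  where
  "orbit \<S> w \<iota> x y = {a. equivclp (\<lambda>b c. sim_x \<S> w \<iota> b c \<or> sim_y \<S> w \<iota> b c) (x, y) a}"

definition x_edges ::
  "(int \<times> int) set \<Rightarrow> (int \<times> int \<Rightarrow> complex) \<Rightarrow> (complex \<Rightarrow> 'k::field) \<Rightarrow> 'k \<Rightarrow> 'k
    \<Rightarrow> (('k \<times> 'k) \<times> ('k \<times> 'k)) set" where
  "x_edges \<S> w \<iota> x y =
     {(a, b). a \<in> orbit \<S> w \<iota> x y \<and> b \<in> orbit \<S> w \<iota> x y \<and> a \<noteq> b \<and> sim_x \<S> w \<iota> a b}"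

definition y_edges ::
  "(int \<times> int) set \<Rightarrow> (int \<times> int \<Rightarrow> complex) \<Rightarrow> (complex \<Rightarrow> 'k::field) \<Rightarrow> 'k \<Rightarrow> 'k
    \<Rightarrow> (('k \<times> 'k) \<times> ('k \<times> 'k)) set" where
  "y_edges \<S> w \<iota> x y =
     {(a, b). a \<in> orbit \<S> w \<iota> x y \<and> b \<in> orbit \<S> w \<iota> x y \<and> a \<noteq> b \<and> sim_y \<S> w \<iota> a b}"

definition is_orientation ::
  "(int \<times> int) set \<Rightarrow> (int \<times> int \<Rightarrow> complex) \<Rightarrow> (complex \<Rightarrow> 'k::field) \<Rightarrow> 'k \<Rightarrow> 'k
    \<Rightarrow> (('k \<times> 'k) \<times> ('k \<times> 'k)) set \<Rightarrow> bool" where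
  "is_orientation \<S> w \<iota> x y Arcs \<longleftrightarrow>
     Arcs \<subseteq> x_edges \<S> w \<iota> x y \<union> y_edges \<S> w \<iota> x y \<and>
     (\<forall>(a, b) \<in> x_edges \<S> w \<iota> x y \<union> y_edges \<S> w \<iota> x y. (a, b) \<in> Arcs \<longleftrightarrow> (b, a) \<notin> Arcs)"

text \<open>Chains: 0-chains have support in the orbit, 1-chains have support in the set of arcs.\<close>

definition chains_on :: "'a set \<Rightarrow> ('a \<Rightarrow>\<^sub>0 complex) set" where
  "chains_on A = {c. Poly_Mapping.keys c \<subseteq> A}"

definition chain_scale :: "complex \<Rightarrow> ('a \<Rightarrow>\<^sub>0 complex) \<Rightarrow> ('a \<Rightarrow>\<^sub>0 complex)" where
  "chain_scale z c = Poly_Mapping.map (\<lambda>t. z * t) c"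

definition vertex_chain :: "'a \<Rightarrow> ('a \<Rightarrow>\<^sub>0 complex)" where
  "vertex_chain a = Poly_Mapping.single a 1"

(* The linear map (a,a') |-> a' - a on arcs in B, and 0 on the other arcs. *)
definition boundary_on :: "('a \<times> 'a) set \<Rightarrow> (('a \<times> 'a) \<Rightarrow>\<^sub>0 complex) \<Rightarrow> ('a \<Rightarrow>\<^sub>0 complex)" where
  "boundary_on B c =
     (\<Sum>(a, a')\<in>Poly_Mapping.keys c \<inter> B.
        chain_scale (Poly_Mapping.lookup c (a, a')) (vertex_chain a' - vertex_chain a))"

definition boundary :: "(('a \<times> 'a) \<Rightarrow>\<^sub>0 complex) \<Rightarrow> ('a \<Rightarrow>\<^sub>0 complex)" where
  "boundary c = boundary_on UNIV c"

definition boundary_x ::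
  "(int \<times> int) set \<Rightarrow> (int \<times> int \<Rightarrow> complex) \<Rightarrow> (complex \<Rightarrow> 'k::field) \<Rightarrow> 'k \<Rightarrow> 'k
    \<Rightarrow> ((('k \<times> 'k) \<times> ('k \<times> 'k)) \<Rightarrow>\<^sub>0 complex) \<Rightarrow> (('k \<times> 'k) \<Rightarrow>\<^sub>0 complex)" where
  "boundary_x \<S> w \<iota> x y c = boundary_on (x_edges \<S> w \<iota> x y) c"

definition boundary_y ::
  "(int \<times> int) set \<Rightarrow> (int \<times> int \<Rightarrow> complex) \<Rightarrow> (complex \<Rightarrow> 'k::field) \<Rightarrow> 'k \<Rightarrow> 'k
    \<Rightarrow> ((('k \<times> 'k) \<times> ('k \<times> 'k)) \<Rightarrow>\<^sub>0 complex) \<Rightarrow> (('k \<times> 'k) \<Rightarrow>\<^sub>0 complex)" where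
  "boundary_y \<S> w \<iota> x y c = boundary_on (y_edges \<S> w \<iota> x y) c"

definition eps_x_zero :: "(('k \<times> 'k) \<Rightarrow>\<^sub>0 complex) \<Rightarrow> bool" where
  "eps_x_zero \<beta> \<longleftrightarrow> (\<forall>u. (\<Sum>a\<in>{a \<in> Poly_Mapping.keys \<beta>. fst a = u}. Poly_Mapping.lookup \<beta> a) = 0)"

definition eps_y_zero :: "(('k \<times> 'k) \<Rightarrow>\<^sub>0 complex) \<Rightarrow> bool" where
  "eps_y_zero \<beta> \<longleftrightarrow> (\<forall>v. (\<Sum>a\<in>{a \<in> Poly_Mapping.keys \<beta>. snd a = v}. Poly_Mapping.lookup \<beta> a) = 0)"

definition omega ::
  "(int \<times> int) set \<Rightarrow> (int \<times> int \<Rightarrow> complex) \<Rightarrow> (complex \<Rightarrow> 'k::field) \<Rightarrow> 'k \<Rightarrow> 'k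
    \<Rightarrow> (('k \<times> 'k) \<Rightarrow>\<^sub>0 complex)" where
  "omega \<S> w \<iota> x y =
     chain_scale (1 / of_nat (card (orbit \<S> w \<iota> x y))) (\<Sum>a\<in>orbit \<S> w \<iota> x y. vertex_chain a)"

definition gamma_x ::
  "(int \<times> int) set \<Rightarrow> (int \<times> int \<Rightarrow> complex) \<Rightarrow> (complex \<Rightarrow> 'k::field) \<Rightarrow> 'k \<Rightarrow> 'k
    \<Rightarrow> ('k \<times> 'k \<Rightarrow> ((('k \<times> 'k) \<times> ('k \<times> 'k)) \<Rightarrow>\<^sub>0 complex)) \<Rightarrow> (('k \<times> 'k) \<Rightarrow>\<^sub>0 complex)" where
  "gamma_x \<S> w \<iota> x y p =
     chain_scale (- 1 / of_nat (card (orbit \<S> w \<iota> x y)))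
       (\<Sum>a\<in>orbit \<S> w \<iota> x y. boundary_y \<S> w \<iota> x y (p a))"

definition gamma_y ::
  "(int \<times> int) set \<Rightarrow> (int \<times> int \<Rightarrow> complex) \<Rightarrow> (complex \<Rightarrow> 'k::field) \<Rightarrow> 'k \<Rightarrow> 'k
    \<Rightarrow> ('k \<times> 'k \<Rightarrow> ((('k \<times> 'k) \<times> ('k \<times> 'k)) \<Rightarrow>\<^sub>0 complex)) \<Rightarrow> (('k \<times> 'k) \<Rightarrow>\<^sub>0 complex)" where
  "gamma_y \<S> w \<iota> x y p =
     chain_scale (- 1 / of_nat (card (orbit \<S> w \<iota> x y)))
       (\<Sum>a\<in>orbit \<S> w \<iota> x y. boundary_x \<S> w \<iota> x y (p a))"

(* quot_of_fract H is the normalized pair (A, B) with A, B coprime and H = A/B. *)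
definition regular_frac :: "(int \<times> int) set \<Rightarrow> (int \<times> int \<Rightarrow> complex) \<Rightarrow> frac_XYt \<Rightarrow> bool" where
  "regular_frac \<S> w H \<longleftrightarrow> \<not> kernel_poly \<S> w dvd snd (quot_of_fract H)"

definition eval_frac :: "(complex \<Rightarrow> 'k::field) \<Rightarrow> frac_XYt \<Rightarrow> 'k \<Rightarrow> 'k \<Rightarrow> 'k \<Rightarrow> 'k" where
  "eval_frac \<iota> H u v s =
     eval_XYt \<iota> (fst (quot_of_fract H)) u v s / eval_XYt \<iota> (snd (quot_of_fract H)) u v s"

definition value_at ::
  "(int \<times> int) set \<Rightarrow> (int \<times> int \<Rightarrow> complex) \<Rightarrow> (complex \<Rightarrow> 'k::field) \<Rightarrow> 'k \<Rightarrow> 'k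
    \<Rightarrow> frac_XYt \<Rightarrow> 'k \<times> 'k \<Rightarrow> 'k" where
  "value_at \<S> w \<iota> x y H a = eval_frac \<iota> H (fst a) (snd a) (1 / step_value \<S> w \<iota> x y)"

definition value_chain ::
  "(int \<times> int) set \<Rightarrow> (int \<times> int \<Rightarrow> complex) \<Rightarrow> (complex \<Rightarrow> 'k::field) \<Rightarrow> 'k \<Rightarrow> 'k
    \<Rightarrow> frac_XYt \<Rightarrow> (('k \<times> 'k) \<Rightarrow>\<^sub>0 complex) \<Rightarrow> 'k" where
  "value_chain \<S> w \<iota> x y H \<beta> =
     (\<Sum>a\<in>Poly_Mapping.keys \<beta>. \<iota> (Poly_Mapping.lookup \<beta> a) * value_at \<S> w \<iota> x y H a)"

(* The arguments A, B have inner variable X (resp. Y) and outer variable t. *)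
definition fracs_Xt :: "frac_XYt set" where
  "fracs_Xt = {Fract (map_poly (\<lambda>q. [:q:]) A) (map_poly (\<lambda>q. [:q:]) B) |
                 (A :: complex poly poly) (B :: complex poly poly). B \<noteq> 0}"

definition fracs_Yt :: "frac_XYt set" where
  "fracs_Yt = {Fract (map_poly (map_poly (\<lambda>c. [:c:])) A) (map_poly (map_poly (\<lambda>c. [:c:])) B) |
                 (A :: complex poly poly) (B :: complex poly poly). B \<noteq> 0}"

definition admits_galois_decoupling ::
  "(int \<times> int) set \<Rightarrow> (int \<times> int \<Rightarrow> complex) \<Rightarrow> frac_XYt \<Rightarrow> bool" where
  "admits_galois_decoupling \<S> w H \<longleftrightarrow>
     (\<exists>F\<in>fracs_Xt. \<exists>E\<in>fracs_Yt. \<exists>R. regular_frac \<S> w R \<and>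
        H = F + E + to_fract (kernel_poly \<S> w) * R)"

definition base_field ::
  "(int \<times> int) set \<Rightarrow> (int \<times> int \<Rightarrow> complex) \<Rightarrow> (complex \<Rightarrow> 'k::field) \<Rightarrow> 'k \<Rightarrow> 'k \<Rightarrow> 'k set" where
  "base_field \<S> w \<iota> x y = gen_subfield (range \<iota> \<union> {step_value \<S> w \<iota> x y})"

definition is_pseudo_decoupling ::
  "(int \<times> int) set \<Rightarrow> (int \<times> int \<Rightarrow> complex) \<Rightarrow> (complex \<Rightarrow> 'k::field) \<Rightarrow> 'k \<Rightarrow> 'k
    \<Rightarrow> (('k \<times> 'k) \<Rightarrow>\<^sub>0 complex) \<Rightarrow> (('k \<times> 'k) \<Rightarrow>\<^sub>0 complex) \<Rightarrow> bool" where
  "is_pseudo_decoupling \<S> w \<iota> x y gx gy \<longleftrightarrow>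
     gx \<in> chains_on (orbit \<S> w \<iota> x y) \<and> gy \<in> chains_on (orbit \<S> w \<iota> x y) \<and>
     (\<forall>H. regular_frac \<S> w H \<and> admits_galois_decoupling \<S> w H \<longrightarrow>
        value_at \<S> w \<iota> x y H (x, y) = value_chain \<S> w \<iota> x y H gx + value_chain \<S> w \<iota> x y H gy \<and>
        value_chain \<S> w \<iota> x y H gx \<in> gen_subfield (base_field \<S> w \<iota> x y \<union> {x}) \<and>
        value_chain \<S> w \<iota> x y H gy \<in> gen_subfield (base_field \<S> w \<iota> x y \<union> {y}))"

end

theory Submission
  imports Defs
begin

text \<open>
  Write \<open>H = F + E + K R\<close>. The kernel is linear in \<open>t\<close> with coprime coefficients, so it is the minimal
  polynomial of \<open>y\<close> over \<open>k(x)\<close> and of \<open>x\<close> over \<open>k(y)\<close>. Hence every orbit point is conjugate to \<open>(x, y)\<close>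
  over \<open>k\<close>, no denominator vanishes on the orbit, and \<open>H\<^sub>a = F\<^sub>a + E\<^sub>a\<close> for every orbit point \<open>a\<close>.
  As \<open>F\<close> depends only on the first coordinate and \<open>E\<close> only on the second, the conditions on the boundaries
  turn the two chains into \<open>F\<^sub>(\<^sub>x\<^sub>,\<^sub>y\<^sub>) + E\<^sub>\<omega>\<close> and \<open>E\<^sub>(\<^sub>x\<^sub>,\<^sub>y\<^sub>) - E\<^sub>\<omega>\<close>. Endomorphisms of the algebraic closure
  that fix \<open>k(x)\<close> or \<open>k(y)\<close> permute the finite orbit, so \<open>E\<^sub>\<omega>\<close> lies in \<open>k(x)\<close> and in \<open>k(y)\<close>.
\<close>

section \<open>Partial field homomorphisms\<close>

text \<open>Each edge of the orbit changes one coordinate, so a map conjugating (x, y) to (u, v) has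
  to forget its value at y before y can get a new image: it is cut down to k(x), over which the
  kernel is the minimal polynomial, and every root of the transported kernel is then an admissible
  image. This cutting down is what calls for homomorphisms with explicit domains. Regularity enters
  through an equivalence: the kernel divides D in C[X,Y,t] exactly when D(x, y, 1/S(x,y)) = 0. So a
  regular denominator is nonzero at (x, y), and conjugacy carries this to the whole orbit.
  Membership in k(x) is tested by the endomorphisms of the closure that fix k(x), which is
  legitimate in characteristic 0. Such a map sends (x, y) to a point with the same first coordinate
  and the same step value, hence to a point of the orbit. The facts about k(y) are those about k(x)
  for the walk reflected in the diagonal.\<close>

text \<open>A field homomorphism defined on a subfield is represented by its graph.\<close>

definition partial_hom :: "('k::field \<times> 'k) set \<Rightarrow> bool" where
  "partial_hom G \<longleftrightarrow> (1, 1) \<in> G \<and>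
     (\<forall>a b c d. (a, b) \<in> G \<longrightarrow> (c, d) \<in> G \<longrightarrow> (a - c, b - d) \<in> G \<and> (a * c, b * d) \<in> G) \<and>
     (\<forall>a b. (a, b) \<in> G \<longrightarrow> (inverse a, inverse b) \<in> G) \<and>
     (\<forall>b. (0, b) \<in> G \<longrightarrow> b = 0)"

text \<open>For a partial homomorphism with graph \<open>G\<close>, this makes \<open>q'\<close> the
  coefficientwise image of \<open>q\<close>. Carrying both polynomials through a construction
  replaces the choice of a function on the domain.\<close>

definition coeffs_rel :: "('k::field \<times> 'k) set \<Rightarrow> 'k poly \<Rightarrow> 'k poly \<Rightarrow> bool" where
  "coeffs_rel G q q' \<longleftrightarrow> (\<forall>i. (coeff q i, coeff q' i) \<in> G)"

text \<open>Minimality of the degree is required, but no leading coefficient 1, so that the kernel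
  can serve without normalisation.\<close>

definition is_min_poly :: "'k::field set \<Rightarrow> 'k \<Rightarrow> 'k poly \<Rightarrow> bool" where
  "is_min_poly L z p \<longleftrightarrow> p \<noteq> 0 \<and> (\<forall>i. coeff p i \<in> L) \<and> poly p z = 0 \<and>
     (\<forall>q. q \<noteq> 0 \<longrightarrow> (\<forall>i. coeff q i \<in> L) \<longrightarrow> poly q z = 0 \<longrightarrow> degree p \<le> degree q)"

text \<open>The candidate for the extension that sends \<open>z\<close> to \<open>z'\<close>.
  Arbitrary degrees are allowed, which makes closure under products immediate; single-valuedness and
  inverses depend on \<open>z'\<close> being a root of the image of a minimal polynomial of
  \<open>z\<close>.\<close>

definition adjoin :: "('k::field \<times> 'k) set \<Rightarrow> 'k \<Rightarrow> 'k \<Rightarrow> ('k \<times> 'k) set" where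
  "adjoin G z z' = {(poly q z, poly q' z') | q q'. coeffs_rel G q q'}"

lemma adjoinI: "coeffs_rel G q q' \<Longrightarrow> (poly q z, poly q' z') \<in> adjoin G z z'"
  unfolding adjoin_def by blast

lemma partial_homD:
  assumes "partial_hom G"
  shows "(1, 1) \<in> G"
    and "(a, b) \<in> G \<Longrightarrow> (c, d) \<in> G \<Longrightarrow> (a - c, b - d) \<in> G"
    and "(a, b) \<in> G \<Longrightarrow> (c, d) \<in> G \<Longrightarrow> (a * c, b * d) \<in> G"
    and "(a, b) \<in> G \<Longrightarrow> (inverse a, inverse b) \<in> G"
    and "(0, b) \<in> G \<Longrightarrow> b = 0"
  using assms unfolding partial_hom_def by blast+

lemma partial_hom_zero: "partial_hom G \<Longrightarrow> (0, 0) \<in> G"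
  using partial_homD(2)[of G 1 1 1 1] partial_homD(1)[of G] by simp

lemma partial_hom_uminus: "partial_hom G \<Longrightarrow> (a, b) \<in> G \<Longrightarrow> (- a, - b) \<in> G"
  using partial_homD(2)[of G 0 0 a b] partial_hom_zero[of G] by simp

lemma partial_hom_add:
  "partial_hom G \<Longrightarrow> (a, b) \<in> G \<Longrightarrow> (c, d) \<in> G \<Longrightarrow> (a + c, b + d) \<in> G"
  using partial_homD(2)[of G a b "- c" "- d"] partial_hom_uminus[of G] by simp

lemma partial_hom_divide:
  "partial_hom G \<Longrightarrow> (a, b) \<in> G \<Longrightarrow> (c, d) \<in> G \<Longrightarrow> (a / c, b / d) \<in> G"
  by (simp add: divide_inverse partial_homD)

lemma partial_hom_unique: "partial_hom G \<Longrightarrow> (a, b) \<in> G \<Longrightarrow> (a, c) \<in> G \<Longrightarrow> b = c"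
  using partial_homD(2)[of G a b a c] partial_homD(5)[of G "b - c"] by simp

lemma partial_hom_inj:
  assumes "partial_hom G" "(a, 0) \<in> G"
  shows "a = 0"
proof (rule ccontr)
  assume "a \<noteq> 0"
  then have "(1, 0) \<in> G"
    using partial_homD(3)[OF assms(1) assms(2) partial_homD(4)[OF assms]] by simp
  then show False
    using partial_hom_unique[OF assms(1) _ partial_homD(1)[OF assms(1)]] by force
qed

lemma partial_hom_sum:
  assumes "partial_hom G" "\<And>i. i \<in> I \<Longrightarrow> (f i, g i) \<in> G"
  shows "(sum f I, sum g I) \<in> G"
  using assms(2)
  by (induction I rule: infinite_finite_induct)
     (auto simp: partial_hom_zero[OF assms(1)] intro!: partial_hom_add[OF assms(1)])

lemma partial_hom_power: "partial_hom G \<Longrightarrow> (a, b) \<in> G \<Longrightarrow> (a ^ n, b ^ n) \<in> G"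
  by (induction n) (auto intro: partial_homD)

text \<open>That \<open>Id_on L\<close> is a partial homomorphism is the way to say that
  \<open>L\<close> is a subfield. The restriction serves in \<open>conjugate_step\<close> to shrink
  a domain to k(x).\<close>

lemma partial_hom_restrict:
  assumes "partial_hom G" "partial_hom (Id_on L)"
  shows "partial_hom (G \<inter> L \<times> UNIV)"
proof -
  have L: "1 \<in> L" "\<And>a b. a \<in> L \<Longrightarrow> b \<in> L \<Longrightarrow> a - b \<in> L \<and> a * b \<in> L" "\<And>a. a \<in> L \<Longrightarrow> inverse a \<in> L"
    using partial_homD(1-4)[OF assms(2)] by (auto simp: Id_on_iff)
  show ?thesis
    unfolding partial_hom_def using L partial_homD[OF assms(1)] by (auto simp: mem_Times_iff)
qed

lemma partial_hom_Id_on_gen_subfield: "partial_hom (Id_on (gen_subfield A))"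
  unfolding partial_hom_def by (auto intro: gen_subfield.intros)

lemma gen_subfield_subset_Domain:
  assumes "partial_hom G" "A \<subseteq> Domain G"
  shows "gen_subfield A \<subseteq> Domain G"
proof
  fix a assume "a \<in> gen_subfield A"
  then show "a \<in> Domain G"
    by induction (use assms in \<open>auto intro: partial_homD Domain.intros\<close>)
qed

lemma gen_subfield_subset:
  "partial_hom (Id_on L) \<Longrightarrow> A \<subseteq> L \<Longrightarrow> gen_subfield A \<subseteq> L"
  using gen_subfield_subset_Domain[of "Id_on L" A] by (auto simp: Domain_Id_on)

section \<open>Polynomials with related coefficients\<close>

lemma coeffs_rel_add: "partial_hom G \<Longrightarrow> coeffs_rel G p p' \<Longrightarrow> coeffs_rel G q q' \<Longrightarrow> coeffs_rel G (p + q) (p' + q')"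
  unfolding coeffs_rel_def by (simp add: partial_hom_add)

lemma coeffs_rel_diff: "partial_hom G \<Longrightarrow> coeffs_rel G p p' \<Longrightarrow> coeffs_rel G q q' \<Longrightarrow> coeffs_rel G (p - q) (p' - q')"
  unfolding coeffs_rel_def by (simp add: partial_homD)

lemma coeffs_rel_mult: "partial_hom G \<Longrightarrow> coeffs_rel G p p' \<Longrightarrow> coeffs_rel G q q' \<Longrightarrow> coeffs_rel G (p * q) (p' * q')"
  unfolding coeffs_rel_def by (auto simp: coeff_mult intro!: partial_hom_sum partial_homD)

lemma coeffs_rel_monom: "partial_hom G \<Longrightarrow> (a, b) \<in> G \<Longrightarrow> coeffs_rel G (monom a n) (monom b n)"
  unfolding coeffs_rel_def by (auto simp: partial_hom_zero)

lemma coeffs_rel_const: "partial_hom G \<Longrightarrow> (a, b) \<in> G \<Longrightarrow> coeffs_rel G [:a:] [:b:]"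
  using coeffs_rel_monom[of G a b 0] by (simp add: monom_0)

lemma coeffs_rel_zero: "partial_hom G \<Longrightarrow> coeffs_rel G 0 q' \<Longrightarrow> q' = 0"
  unfolding coeffs_rel_def by (auto simp: poly_eq_iff intro: partial_homD(5))

lemma coeffs_rel_Id_on: "coeffs_rel (Id_on L) q q' \<longleftrightarrow> q' = q \<and> (\<forall>i. coeff q i \<in> L)"
  unfolding coeffs_rel_def by (auto simp: poly_eq_iff)

text \<open>Long division uses only field operations on coefficients. Performing the same operations
  on the images keeps every pair of coefficients in \<open>G\<close>.\<close>

lemma coeffs_rel_division:
  assumes G: "partial_hom G" and "coeffs_rel G f f'" "coeffs_rel G g g'" "g \<noteq> 0"
  shows "\<exists>s s' t t'. coeffs_rel G s s' \<and> coeffs_rel G t t' \<and> f = g * s + t \<and> f' = g' * s' + t' \<and>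
           (t = 0 \<or> degree t < degree g)"
  using assms(2)
proof (induction "degree f" arbitrary: f f' rule: less_induct)
  case less
  show ?case
  proof (cases "f = 0 \<or> degree f < degree g")
    case True
    show ?thesis
      by (rule exI[of _ 0], rule exI[of _ 0], rule exI[of _ f], rule exI[of _ f'])
         (use True less(2) coeffs_rel_monom[OF G partial_hom_zero[OF G]] in auto)
  next
    case False
    define k where "k = degree f - degree g"
    define c where "c = lead_coeff f / lead_coeff g"
    \<comment> \<open>The coefficients of \<open>f'\<close> and \<open>g'\<close> are read at the
      degrees of \<open>f\<close> and \<open>g\<close>, so \<open>(c, c')\<close> lies in
      \<open>G\<close> without any comparison of degrees.\<close>
    define c' where "c' = coeff f' (degree f) / coeff g' (degree g)"
    define h where "h = f - g * monom c k"
    define h' where "h' = f' - g' * monom c' k"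
    have cc: "(c, c') \<in> G"
      using less(2) assms(3) unfolding c_def c'_def coeffs_rel_def
      by (intro partial_hom_divide[OF G]) auto
    have hh: "coeffs_rel G h h'"
      unfolding h_def h'_def
      by (intro coeffs_rel_diff coeffs_rel_mult coeffs_rel_monom cc G less(2) assms(3))
    have c0: "c \<noteq> 0" using False \<open>g \<noteq> 0\<close> by (simp add: c_def)
    have dk: "degree (g * monom c k) = degree f"
      using c0 \<open>g \<noteq> 0\<close> False by (simp add: degree_mult_eq degree_monom_eq k_def)
    have "degree h \<le> degree f" unfolding h_def using dk by (simp add: degree_diff_le)
    moreover have "coeff h (degree f) = 0"
    proof -
      have "coeff (g * monom c k) (degree f) = lead_coeff g * c"
        using dk c0 by (metis lead_coeff_mult lead_coeff_monom)
      then show ?thesis using \<open>g \<noteq> 0\<close> by (simp add: h_def c_def)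
    qed
    ultimately consider "h = 0" | "degree h < degree f"
      by (metis eq_zero_or_degree_less)
    then show ?thesis
    proof cases
      case 1
      then have "h' = 0" using coeffs_rel_zero[OF G] hh by blast
      show ?thesis
        by (rule exI[of _ "monom c k"], rule exI[of _ "monom c' k"], rule exI[of _ 0], rule exI[of _ 0])
          (use 1 \<open>h' = 0\<close> coeffs_rel_monom[OF G cc] coeffs_rel_monom[OF G partial_hom_zero[OF G]]
           in \<open>auto simp: h_def h'_def\<close>)
    next
      case 2
      obtain s s' t t' where st: "coeffs_rel G s s'" "coeffs_rel G t t'" "h = g * s + t"
          "h' = g' * s' + t'" "t = 0 \<or> degree t < degree g"
        using less(1)[OF 2 hh] by blast
      show ?thesis
        by (rule exI[of _ "s + monom c k"], rule exI[of _ "s' + monom c' k"], rule exI[of _ t], rule exI[of _ t'])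
          (use st coeffs_rel_add[OF G st(1) coeffs_rel_monom[OF G cc]]
           in \<open>auto simp: h_def h'_def algebra_simps\<close>)
    qed
  qed
qed

lemma coeffs_rel_Domain: "coeffs_rel G q q' \<Longrightarrow> coeff q i \<in> Domain G"
  unfolding coeffs_rel_def by blast

section \<open>Adjoining an algebraic element\<close>

lemma min_poly_degree:
  assumes "is_min_poly L z p" shows "degree p > 0"
proof (rule ccontr)
  assume "\<not> degree p > 0"
  then obtain c where "p = [:c:]" by (auto elim: degree_eq_zeroE)
  then show False using assms unfolding is_min_poly_def by auto
qed

text \<open>After reduction modulo \<open>p\<close>, the roles are exchanged and \<open>p\<close> is
  divided by \<open>q\<close>. At \<open>z\<close> the remainder satisfies t(z) = - s(z) q(z) and
  has smaller degree than \<open>q\<close>, so an inverse of t(z), known by induction, yields the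
  inverse - s(z) r(z) of q(z).\<close>

lemma adjoin_inverse:
  assumes G: "partial_hom G" and p: "coeffs_rel G p p'" "is_min_poly (Domain G) z p"
    and "coeffs_rel G q q'" "poly q z \<noteq> 0"
  shows "\<exists>r r'. coeffs_rel G r r' \<and> poly r z * poly q z = 1"
proof -
  have *: "\<exists>r r'. coeffs_rel G r r' \<and> poly r z * poly q z = 1"
    if "coeffs_rel G q q'" "poly q z \<noteq> 0" "degree q < degree p" for q q'
    using that
  proof (induction "degree q" arbitrary: q q' rule: less_induct)
    case less
    from less have "q \<noteq> 0" by auto
    obtain s s' t t' where st: "coeffs_rel G s s'" "coeffs_rel G t t'" "p = q * s + t"
          "t = 0 \<or> degree t < degree q"
      using coeffs_rel_division[OF G p(1) less(2) \<open>q \<noteq> 0\<close>] by blast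
    have pz: "poly q z * poly s z + poly t z = 0"
      using p(2) st(3) unfolding is_min_poly_def by (metis poly_add poly_mult)
    show ?case
    proof (cases "t = 0")
      \<comment> \<open>Here \<open>q\<close> divides \<open>p\<close>. Since q(z) is nonzero, z is
        a root of the cofactor \<open>s\<close>, and minimality of \<open>p\<close> leaves only a
        constant \<open>q\<close>.\<close>
      case True
      then have sz: "poly s z = 0" using pz less by simp
      have "s \<noteq> 0" using st(3) True p(2) unfolding is_min_poly_def by auto
      then have "degree p \<le> degree s"
        using p(2) sz coeffs_rel_Domain[OF st(1)] unfolding is_min_poly_def by blast
      moreover have "degree p = degree q + degree s"
        using True st(3) \<open>s \<noteq> 0\<close> \<open>q \<noteq> 0\<close> by (simp add: degree_mult_eq)
      ultimately have "degree q = 0" by simp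
      then obtain c where c: "q = [:c:]" by (auto elim: degree_eq_zeroE)
      have "(coeff q 0, coeff q' 0) \<in> G" using less(2) unfolding coeffs_rel_def by blast
      then have "coeffs_rel G [:inverse c:] [:inverse (coeff q' 0):]"
        using c by (intro coeffs_rel_const G partial_homD(4)) auto
      then show ?thesis using c less(3) by (intro exI[of _ "[:inverse c:]"] exI[of _ "[:inverse (coeff q' 0):]"]) auto
    next
      case False
      then have dt: "degree t < degree q" using st(4) by simp
      have "poly t z \<noteq> 0"
      proof
        assume "poly t z = 0"
        then have "degree p \<le> degree t"
          using p(2) coeffs_rel_Domain[OF st(2)] False unfolding is_min_poly_def by blast
        then show False using dt less(4) by simp
      qed
      then obtain r r' where r: "coeffs_rel G r r'" "poly r z * poly t z = 1"
        using less(1)[OF dt st(2)] dt less(4) by auto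
      have "coeffs_rel G (0 - s * r) (0 - s' * r')"
        using coeffs_rel_monom[OF G partial_hom_zero[OF G]] 
        by (intro coeffs_rel_diff coeffs_rel_mult G st r) simp
      moreover have "poly (0 - s * r) z * poly q z = 1"
      proof -
        have "poly (0 - s * r) z * poly q z = - (poly q z * poly s z) * poly r z"
          by simp
        also have "\<dots> = poly t z * poly r z" using pz by (simp add: add_eq_0_iff)
        finally show ?thesis using r(2) by (simp add: mult.commute)
      qed
      ultimately show ?thesis by blast
    qed
  qed
  have "p \<noteq> 0" using p(2) unfolding is_min_poly_def by simp
  obtain s s' t t' where st: "coeffs_rel G t t'" "q = p * s + t" "t = 0 \<or> degree t < degree p"
    using coeffs_rel_division[OF G assms(4) p(1) \<open>p \<noteq> 0\<close>] by blast
  have "poly q z = poly t z" using st(2) p(2) unfolding is_min_poly_def by simp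
  then show ?thesis using *[OF st(1)] st(3) assms(5) by auto
qed

text \<open>If q(z) = 0, then minimality makes \<open>p\<close> divide \<open>q\<close>; as the
  division runs in parallel on the images, \<open>p'\<close> divides \<open>q'\<close>, and so
  q'(z') = 0. This is the single-valuedness at 0 from which the behaviour on inverses also
  follows.\<close>

lemma partial_hom_adjoin:
  assumes G: "partial_hom G" and p: "coeffs_rel G p p'" "is_min_poly (Domain G) z p"
    and z': "poly p' z' = 0"
  shows "partial_hom (adjoin G z z')"
proof -
  have single: "poly q' z' = 0" if qq: "coeffs_rel G q q'" "poly q z = 0" for q q'
  proof -
    have "p \<noteq> 0" using p(2) unfolding is_min_poly_def by simp
    obtain s s' t t' where st: "coeffs_rel G t t'" "q = p * s + t" "q' = p' * s' + t'"
        "t = 0 \<or> degree t < degree p"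
      using coeffs_rel_division[OF G qq(1) p(1) \<open>p \<noteq> 0\<close>] by blast
    have "poly t z = 0" using st(2) p(2) qq(2) unfolding is_min_poly_def by simp
    then have "t = 0"
      using st(4) p(2) coeffs_rel_Domain[OF st(1)] unfolding is_min_poly_def by (meson leD)
    then have "t' = 0" using st(1) coeffs_rel_zero[OF G] by blast
    then show ?thesis using st(3) z' by simp
  qed
  have 1: "(1, 1) \<in> adjoin G z z'"
    using adjoinI[OF coeffs_rel_const[OF G partial_homD(1)[OF G]], of z z'] by simp
  have 2: "(a - c, b - d) \<in> adjoin G z z'" "(a * c, b * d) \<in> adjoin G z z'"
    if ab: "(a, b) \<in> adjoin G z z'" and cd: "(c, d) \<in> adjoin G z z'" for a b c d
  proof -
    obtain q q' r r' where qr: "coeffs_rel G q q'" "coeffs_rel G r r'" "a = poly q z" "b = poly q' z'"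
       "c = poly r z" "d = poly r' z'"
      using ab cd unfolding adjoin_def by auto
    show "(a - c, b - d) \<in> adjoin G z z'"
      using adjoinI[OF coeffs_rel_diff[OF G qr(1,2)], of z z'] qr by simp
    show "(a * c, b * d) \<in> adjoin G z z'"
      using adjoinI[OF coeffs_rel_mult[OF G qr(1,2)], of z z'] qr by simp
  qed
  have 4: "b = 0" if "(0, b) \<in> adjoin G z z'" for b
    using single that unfolding adjoin_def by force
  have 3: "(inverse a, inverse b) \<in> adjoin G z z'" if ab: "(a, b) \<in> adjoin G z z'" for a b
  proof (cases "a = 0")
    case True
    then show ?thesis using that 4[of b] by auto
  next
    case False
    obtain q q' where q: "coeffs_rel G q q'" "a = poly q z" "b = poly q' z'"
      using ab unfolding adjoin_def by auto
    obtain r r' where r: "coeffs_rel G r r'" "poly r z * a = 1"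
      using adjoin_inverse[OF G p q(1)] False q(2) by auto
    have rr: "(poly r z, poly r' z') \<in> adjoin G z z'" unfolding adjoin_def using r by blast
    have "(1, poly r' z' * b) \<in> adjoin G z z'" using 2(2)[OF rr ab] r by simp
    then have "(0, poly r' z' * b - 1) \<in> adjoin G z z'"
      using 2(1)[OF _ 1] by fastforce
    then have "poly r' z' * b = 1" using 4 by force
    then have "inverse b = poly r' z'" "inverse a = poly r z"
      using r(2) by (metis inverse_unique mult.commute)+
    then show ?thesis using rr by simp
  qed
  show ?thesis unfolding partial_hom_def using 1 2 3 4 by blast
qed

lemma adjoin_supset: "partial_hom G \<Longrightarrow> G \<subseteq> adjoin G z z'"
proof clarify
  fix a b assume "partial_hom G" "(a, b) \<in> G"
  then show "(a, b) \<in> adjoin G z z'"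
    using adjoinI[OF coeffs_rel_const, of G a b z z'] by simp
qed

lemma adjoin_generator: "partial_hom G \<Longrightarrow> (z, z') \<in> adjoin G z z'"
  using adjoinI[OF coeffs_rel_monom[OF _ partial_homD(1)], of G 1 z z'] by (simp add: poly_monom)

section \<open>Extension of homomorphisms to the whole field\<close>

lemma min_poly_exists:
  assumes "algebraic_over_subfield L z"
  shows "\<exists>p. is_min_poly L z p"
proof -
  let ?P = "\<lambda>p. p \<noteq> 0 \<and> (\<forall>i. coeff p i \<in> L) \<and> poly p z = 0"
  obtain p where "?P p" "\<forall>q. ?P q \<longrightarrow> degree p \<le> degree q"
    using ex_has_least_nat[of ?P _ degree] assms unfolding algebraic_over_subfield_def by metis
  then show ?thesis unfolding is_min_poly_def by blast
qed

lemma algebraic_over_subfield_mono: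
  "algebraic_over_subfield L z \<Longrightarrow> L \<subseteq> M \<Longrightarrow> algebraic_over_subfield M z"
  unfolding algebraic_over_subfield_def by blast

text \<open>Algebraic closedness supplies a root of the image of the minimal polynomial of
  \<open>z\<close>. Sending \<open>z\<close> there extends \<open>G\<close>, and by maximality the
  extension is \<open>G\<close> itself.\<close>

lemma maximal_partial_hom_Domain:
  fixes G :: "('k::alg_closed_field \<times> 'k) set"
  assumes G: "partial_hom G" and max: "\<And>G'. partial_hom G' \<Longrightarrow> G \<subseteq> G' \<Longrightarrow> G' = G"
    and alg: "algebraic_over_subfield (Domain G) z"
  shows "z \<in> Domain G"
proof -
  obtain p where p: "is_min_poly (Domain G) z p" using min_poly_exists[OF alg] by blast
  define f where "f a = (SOME b. (a, b) \<in> G)" for a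
  have f: "(a, f a) \<in> G" if "a \<in> Domain G" for a
    using that unfolding f_def by (metis Domain.cases someI)
  have f0: "f 0 = 0"
    using f[of 0] partial_hom_zero[OF G] partial_homD(5)[OF G] by blast
  have rel: "coeffs_rel G p (map_poly f p)"
    using p f unfolding coeffs_rel_def is_min_poly_def by (simp add: coeff_map_poly f0)
  \<comment> \<open>Injectivity keeps the leading coefficient alive, so the image of
    \<open>p\<close> has the positive degree of \<open>p\<close> and therefore a root.\<close>
  have "f (lead_coeff p) \<noteq> 0"
    using f[of "lead_coeff p"] p partial_hom_inj[OF G, of "lead_coeff p"] unfolding is_min_poly_def by auto
  then have "degree (map_poly f p) = degree p"
    by (intro map_poly_degree_eq) auto
  then obtain z' where "poly (map_poly f p) z' = 0"
    using alg_closed_imp_poly_has_root min_poly_degree[OF p] by metis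
  then have "adjoin G z z' = G"
    using max[OF partial_hom_adjoin[OF G rel p] adjoin_supset[OF G]] by blast
  then show ?thesis using adjoin_generator[OF G, of z z'] by auto
qed

lemma partial_hom_Union_chain:
  assumes "C \<noteq> {}" "\<And>G. G \<in> C \<Longrightarrow> partial_hom G"
    and "\<And>G H. G \<in> C \<Longrightarrow> H \<in> C \<Longrightarrow> G \<subseteq> H \<or> H \<subseteq> G"
  shows "partial_hom (\<Union>C)"
proof -
  have 1: "(a - c, b - d) \<in> \<Union>C \<and> (a * c, b * d) \<in> \<Union>C"
    if ab: "(a, b) \<in> \<Union>C" and cd: "(c, d) \<in> \<Union>C" for a b c d
  proof -
    obtain G H where GH: "G \<in> C" "(a, b) \<in> G" "H \<in> C" "(c, d) \<in> H" using ab cd by blast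
    then obtain U where U: "U \<in> C" "(a, b) \<in> U" "(c, d) \<in> U" using assms(3)[of G H] by blast
    then show ?thesis using partial_homD(2,3)[OF assms(2)[OF U(1)] U(2,3)] by blast
  qed
  have 2: "(inverse a, inverse b) \<in> \<Union>C" if ab: "(a, b) \<in> \<Union>C" for a b
  proof -
    obtain U where U: "U \<in> C" "(a, b) \<in> U" using ab by blast
    then show ?thesis using partial_homD(4)[OF assms(2)[OF U(1)] U(2)] by blast
  qed
  have 3: "b = 0" if ab: "(0, b) \<in> \<Union>C" for b
  proof -
    obtain U where U: "U \<in> C" "(0, b) \<in> U" using ab by blast
    then show ?thesis using partial_homD(5)[OF assms(2)[OF U(1)] U(2)] by blast
  qed
  have 4: "(1, 1) \<in> \<Union>C"
    using assms(1,2) partial_homD(1) by blast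
  show ?thesis unfolding partial_hom_def
    by (intro conjI allI impI) (use 1 2 3 4 in blast)+
qed

definition field_hom :: "('k::field \<Rightarrow> 'k) \<Rightarrow> bool" where
  "field_hom \<sigma> \<longleftrightarrow> partial_hom {(a, \<sigma> a) | a. True}"

text \<open>The hypotheses follow the tower k(x), k(x, y), closure in which the lemma is applied: a
  maximal extension given by Zorn's lemma has \<open>y\<close> in its domain, hence the field
  generated by \<open>y\<close> and the old domain, hence everything algebraic over that
  field.\<close>

lemma partial_hom_extends:
  fixes G :: "('k::alg_closed_field \<times> 'k) set"
  assumes G: "partial_hom G" and y: "algebraic_over_subfield (Domain G) y"
    and alg: "\<And>z. algebraic_over_subfield (gen_subfield (insert y (Domain G))) z"
  shows "\<exists>\<sigma>. field_hom \<sigma> \<and> (\<forall>(a, b)\<in>G. \<sigma> a = b)"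
proof -
  define \<A> where "\<A> = {G'. partial_hom G' \<and> G \<subseteq> G'}"
  have "\<exists>M\<in>\<A>. \<forall>X\<in>\<A>. M \<subseteq> X \<longrightarrow> X = M"
  proof (rule subset_Zorn_nonempty)
    show "\<A> \<noteq> {}" using G unfolding \<A>_def by blast
  next
    fix C assume C: "C \<noteq> {}" "subset.chain \<A> C"
    then have "\<And>X Y. X \<in> C \<Longrightarrow> Y \<in> C \<Longrightarrow> X \<subseteq> Y \<or> Y \<subseteq> X" "C \<subseteq> \<A>"
      unfolding subset.chain_def by blast+
    then show "\<Union>C \<in> \<A>" using C(1) partial_hom_Union_chain[of C] unfolding \<A>_def by blast
  qed
  then obtain M where M: "partial_hom M" "G \<subseteq> M" "\<And>X. partial_hom X \<Longrightarrow> M \<subseteq> X \<Longrightarrow> X = M"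
    unfolding \<A>_def by auto
  have GM: "Domain G \<subseteq> Domain M" using M(2) by blast
  have "y \<in> Domain M"
    using maximal_partial_hom_Domain[OF M(1) M(3)] algebraic_over_subfield_mono[OF y GM] by blast
  then have "gen_subfield (insert y (Domain G)) \<subseteq> Domain M"
    using gen_subfield_subset_Domain[OF M(1)] GM by blast
  then have tot: "z \<in> Domain M" for z
    using maximal_partial_hom_Domain[OF M(1) M(3)] algebraic_over_subfield_mono[OF alg] by blast
  define \<sigma> where "\<sigma> a = (SOME b. (a, b) \<in> M)" for a
  have \<sigma>: "(a, \<sigma> a) \<in> M" for a
    using tot[of a] unfolding \<sigma>_def by (metis Domain.cases someI)
  have M_graph: "{(a, \<sigma> a) | a. True} = M"
  proof (intro equalityI subsetI)
    fix e assume "e \<in> M"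
    then show "e \<in> {(a, \<sigma> a) | a. True}"
      using partial_hom_unique[OF M(1) \<sigma>, of "fst e" "snd e"] by (cases e) simp
  qed (use \<sigma> in auto)
  have "field_hom \<sigma>" unfolding field_hom_def M_graph by (rule M(1))
  moreover have "\<sigma> a = b" if "(a, b) \<in> G" for a b
    using that M(2) \<sigma>[of a] partial_hom_unique[OF M(1)] by blast
  ultimately show ?thesis by blast
qed

lemma field_homD:
  assumes "field_hom \<sigma>"
  shows "\<sigma> 1 = 1" "\<sigma> 0 = 0" "\<sigma> (a - b) = \<sigma> a - \<sigma> b" "\<sigma> (a + b) = \<sigma> a + \<sigma> b"
    "\<sigma> (a * b) = \<sigma> a * \<sigma> b" "\<sigma> (inverse a) = inverse (\<sigma> a)" "\<sigma> (a / b) = \<sigma> a / \<sigma> b"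
    "\<sigma> a = 0 \<longleftrightarrow> a = 0" "inj \<sigma>"
proof -
  have P: "partial_hom {(a, \<sigma> a) | a. True}" using assms by (simp add: field_hom_def)
  show "\<sigma> 1 = 1" using partial_homD(1)[OF P] by simp
  show 0: "\<sigma> 0 = 0" using partial_hom_zero[OF P] by simp
  show d: "\<sigma> (a - b) = \<sigma> a - \<sigma> b" for a b using partial_homD(2)[OF P, of a "\<sigma> a" b "\<sigma> b"] by simp
  show "\<sigma> (a + b) = \<sigma> a + \<sigma> b" using partial_hom_add[OF P, of a "\<sigma> a" b "\<sigma> b"] by simp
  show "\<sigma> (a * b) = \<sigma> a * \<sigma> b" using partial_homD(3)[OF P, of a "\<sigma> a" b "\<sigma> b"] by simp
  show "\<sigma> (inverse a) = inverse (\<sigma> a)" using partial_homD(4)[OF P, of a "\<sigma> a"] by simp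
  show "\<sigma> (a / b) = \<sigma> a / \<sigma> b" using partial_hom_divide[OF P, of a "\<sigma> a" b "\<sigma> b"] by simp
  show i: "\<sigma> a = 0 \<longleftrightarrow> a = 0" for a using partial_hom_inj[OF P, of a] 0 by auto
  show "inj \<sigma>" using i d by (metis injI right_minus_eq)
qed

lemma field_hom_sum:
  assumes "field_hom \<sigma>"
  shows "\<sigma> (sum f A) = (\<Sum>a\<in>A. \<sigma> (f a))"
  by (induction A rule: infinite_finite_induct) (auto simp: field_homD(2,4)[OF assms])

section \<open>Separability and fixed fields\<close>

lemma simple_roots_dvd:
  fixes p h :: "'k::alg_closed_field poly"
  assumes "p \<noteq> 0" "\<And>a. poly p a = 0 \<Longrightarrow> poly h a = 0 \<and> poly (pderiv p) a \<noteq> 0"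
  shows "p dvd h"
  using assms
proof (induction "degree p" arbitrary: p h rule: less_induct)
  case less
  show ?case
  proof (cases "degree p = 0")
    case True
    then show ?thesis using less(2) unit_imp_dvd[of p h] by (simp add: is_unit_iff_degree)
  next
    case False
    then obtain a where a: "poly p a = 0" using alg_closed_imp_poly_has_root[of p] by auto
    then obtain r where r: "p = [:- a, 1:] * r" by (auto simp: poly_eq_0_iff_dvd elim: dvdE)
    have "[:- a, 1:] dvd h" using less(3)[OF a] by (simp add: poly_eq_0_iff_dvd)
    then obtain g where g: "h = [:- a, 1:] * g" by (elim dvdE)
    have "r \<noteq> 0" using r less(2) by auto
    then have "degree p = Suc (degree r)" unfolding r by (subst degree_mult_eq) auto
    have dp: "pderiv p = r + [:- a, 1:] * pderiv r"
      unfolding r pderiv_mult by (simp add: pderiv_pCons)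
    \<comment> \<open>At the root \<open>a\<close> the derivative of \<open>p\<close> takes the
      value r(a). So \<open>a\<close> is not a root of \<open>r\<close>, and the linear factor split
      off from \<open>h\<close> does not vanish at the roots of \<open>r\<close>: these remain roots
      of \<open>g\<close>, and simple roots of \<open>r\<close>.\<close>
    have ra: "poly r a \<noteq> 0" using less(3)[OF a] by (simp add: dp)
    have "r dvd g"
    proof (rule less(1))
      show "degree r < degree p" using \<open>degree p = Suc (degree r)\<close> by simp
      fix b assume b: "poly r b = 0"
      then have "b \<noteq> a" using ra by auto
      have "poly p b = 0" using b r by simp
      then have "poly h b = 0" "poly (pderiv p) b \<noteq> 0" using less(3) by auto
      then show "poly g b = 0 \<and> poly (pderiv r) b \<noteq> 0"
        using \<open>b \<noteq> a\<close> b g dp by auto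
    qed fact
    then show ?thesis unfolding r g by (rule mult_dvd_mono[OF dvd_refl])
  qed
qed

text \<open>Suppose \<open>q\<close> takes one value at all roots of \<open>p\<close>. The remainder
  \<open>t\<close> of \<open>q\<close> modulo \<open>p\<close> minus that value vanishes at all
  these roots, which are simple in characteristic 0, so it is divisible by \<open>p\<close>. Having
  smaller degree it is 0, and then q(y) is the constant coefficient of \<open>t\<close>, which lies
  in \<open>L\<close>.\<close>

lemma min_poly_separates:
  fixes L :: "'k::alg_closed_field set"
  assumes L: "partial_hom (Id_on L)" and p: "is_min_poly L y p"
    and char0: "\<And>n::nat. n > 0 \<Longrightarrow> (of_nat n :: 'k) \<noteq> 0"
    and q: "\<And>i. coeff q i \<in> L" and "poly q y \<notin> L"
  shows "\<exists>y'. poly p y' = 0 \<and> poly q y' \<noteq> poly q y"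
proof (rule ccontr)
  assume contra: "\<nexists>y'. poly p y' = 0 \<and> poly q y' \<noteq> poly q y"
  have pL: "coeff p i \<in> L" for i using p unfolding is_min_poly_def by blast
  have Dom: "Domain (Id_on L) = L" by auto
  have rel: "coeffs_rel (Id_on L) p p" using pL by (simp add: coeffs_rel_Id_on)
  have nat: "of_nat n \<in> L" for n
  proof (induction n)
    case (Suc n)
    then show ?case
      using partial_hom_add[OF L, of 1 1 "of_nat n" "of_nat n"] partial_homD(1)[OF L] by auto
  qed (use partial_hom_zero[OF L] in auto)
  have pd: "coeff (pderiv p) i \<in> L" for i
    unfolding coeff_pderiv
    using partial_homD(3)[OF L, of "of_nat (Suc i)" "of_nat (Suc i)" "coeff p (Suc i)" "coeff p (Suc i)"]
      nat[of "Suc i"] pL[of "Suc i"] by auto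
  have dp: "degree p > 0" by (rule min_poly_degree[OF p])
  have pd0: "pderiv p \<noteq> 0"
  proof
    assume "pderiv p = 0"
    then have "coeff (pderiv p) (degree p - 1) = 0" by simp
    then have "of_nat (degree p) * lead_coeff p = 0"
      unfolding coeff_pderiv using dp by (simp del: of_nat_Suc)
    then show False using char0[OF dp] p by (auto simp: is_min_poly_def)
  qed
  have pdy: "poly (pderiv p) y \<noteq> 0"
  proof
    assume "poly (pderiv p) y = 0"
    then have "degree p \<le> degree (pderiv p)"
      using pd pd0 p unfolding is_min_poly_def by blast
    moreover have "degree (pderiv p) \<le> degree p - 1"
      by (rule degree_le) (auto simp: coeff_pderiv coeff_eq_0)
    ultimately show False using dp by simp
  qed
  have "p \<noteq> 0" using p unfolding is_min_poly_def by blast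
  obtain s s' t t' where st: "coeffs_rel (Id_on L) t t'" "q = p * s + t" "t = 0 \<or> degree t < degree p"
    using coeffs_rel_division[OF L _ rel \<open>p \<noteq> 0\<close>, of q q] q by (auto simp: coeffs_rel_Id_on)
  have tq: "poly t a = poly q a" if "poly p a = 0" for a using st(2) that by simp
  have py: "poly p y = 0" using p unfolding is_min_poly_def by blast
  define h where "h = t - [:poly t y:]"
  have "p dvd h"
  proof (rule simple_roots_dvd[OF \<open>p \<noteq> 0\<close>])
    fix a assume a: "poly p a = 0"
    have "poly q a = poly q y" using contra a by blast
    then have "poly h a = 0" using tq[OF a] tq[OF py] by (simp add: h_def)
    moreover have "poly (pderiv p) a \<noteq> 0"
    proof
      \<comment> \<open>Any other root \<open>a\<close> of \<open>p\<close> is conjugate to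
        \<open>y\<close> over \<open>L\<close>. The injective map sending \<open>y\<close> to
        \<open>a\<close> takes p'(y), which is nonzero, to p'(a).\<close>
      have hom: "partial_hom (adjoin (Id_on L) y a)"
        using partial_hom_adjoin[OF L rel _ a] p by simp
      assume "poly (pderiv p) a = 0"
      moreover have "(poly (pderiv p) y, poly (pderiv p) a) \<in> adjoin (Id_on L) y a"
        unfolding adjoin_def using pd by (auto simp: coeffs_rel_Id_on)
      ultimately show False using pdy partial_hom_inj[OF hom] by simp
    qed
    ultimately show "poly h a = 0 \<and> poly (pderiv p) a \<noteq> 0" by blast
  qed
  moreover have "degree h < degree p"
    unfolding h_def using st(3) dp by (intro degree_diff_less) auto
  ultimately have "h = 0" using dvd_imp_degree_le[of p h] by (cases "h = 0") auto
  then have "coeff h 0 = 0" by simp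
  then have "poly t y = coeff t 0" unfolding h_def by simp
  then show False
    using st(1) assms(5) tq[OF py] by (auto simp: coeffs_rel_Id_on)
qed

text \<open>Only \<open>y\<close> is assumed algebraic over \<open>L\<close>; distinguishing whether \<open>z\<close> lies in \<open>L(y)\<close> avoids showing
  that \<open>z\<close> is algebraic over \<open>L\<close>.\<close>

lemma fixed_field:
  fixes L :: "'k::alg_closed_field set"
  assumes L: "partial_hom (Id_on L)" and y: "algebraic_over_subfield L y"
    and alg: "\<And>z. algebraic_over_subfield (gen_subfield (insert y L)) z"
    and char0: "\<And>n::nat. n > 0 \<Longrightarrow> (of_nat n :: 'k) \<noteq> 0"
    and fixed: "\<And>\<sigma>. field_hom \<sigma> \<Longrightarrow> (\<And>a. a \<in> L \<Longrightarrow> \<sigma> a = a) \<Longrightarrow> \<sigma> z = z"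
  shows "z \<in> L"
proof (rule ccontr)
  assume "z \<notin> L"
  obtain p where p: "is_min_poly L y p" using min_poly_exists[OF y] by blast
  \<comment> \<open>An intermediate field \<open>M\<close> with a generator \<open>b\<close> covers
    both cases below: \<open>M = L\<close> and \<open>b = y\<close> if \<open>z\<close> lies in
    L(y), and \<open>M\<close> equal to L(y) with \<open>b = z\<close> and \<open>q\<close> the
    identity polynomial otherwise.\<close>
  have step: "\<exists>\<sigma>. field_hom \<sigma> \<and> (\<forall>a\<in>L. \<sigma> a = a) \<and> \<sigma> z \<noteq> z"
    if M: "partial_hom (Id_on M)" "L \<subseteq> M" "is_min_poly M b p" "\<And>i. coeff q i \<in> M" "poly q b \<notin> M"
      "poly q b = z" for M b p q
  proof -
    obtain b' where b': "poly p b' = 0" "poly q b' \<noteq> z"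
      using min_poly_separates[OF M(1,3) char0 M(4,5)] M(6) by blast
    have Dom: "Domain (Id_on M) = M" by auto
    have "coeffs_rel (Id_on M) p p" using M(3) by (simp add: coeffs_rel_Id_on is_min_poly_def)
    then have hom: "partial_hom (adjoin (Id_on M) b b')"
      using partial_hom_adjoin[OF M(1) _ _ b'(1)] M(3) by simp
    have sup: "Id_on M \<subseteq> adjoin (Id_on M) b b'" by (rule adjoin_supset[OF M(1)])
    then have LD: "L \<subseteq> Domain (adjoin (Id_on M) b b')" using M(2) by auto
    have mono: "gen_subfield (insert y L) \<subseteq> gen_subfield (insert y (Domain (adjoin (Id_on M) b b')))"
      by (rule gen_subfield_subset[OF partial_hom_Id_on_gen_subfield])
         (use LD in \<open>auto intro: gen_subfield.base\<close>)
    obtain \<sigma> where \<sigma>: "field_hom \<sigma>" "\<forall>(a, b)\<in>adjoin (Id_on M) b b'. \<sigma> a = b"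
      using partial_hom_extends[OF hom algebraic_over_subfield_mono[OF y LD]
          algebraic_over_subfield_mono[OF alg mono]] by blast
    have "(z, poly q b') \<in> adjoin (Id_on M) b b'"
      unfolding adjoin_def using M(4,6) by (auto simp: coeffs_rel_Id_on)
    then show ?thesis using \<sigma> b'(2) sup M(2) by (intro exI[of _ \<sigma>]) fastforce
  qed
  define M where "M = {poly q y | q. \<forall>i. coeff q i \<in> L}"
  \<comment> \<open>\<open>M\<close> is L(y). Viewed as the extension of the identity of
    \<open>L\<close> by sending \<open>y\<close> to itself, its identity map is a partial
    homomorphism, which is how \<open>M\<close> is seen to be a field.\<close>
  have M_eq: "adjoin (Id_on L) y y = Id_on M"
    unfolding adjoin_def M_def by (auto simp: coeffs_rel_Id_on)
  have Dom: "Domain (Id_on L) = L" by auto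
  have "coeffs_rel (Id_on L) p p" using p by (simp add: coeffs_rel_Id_on is_min_poly_def)
  then have hom: "partial_hom (Id_on M)"
    using partial_hom_adjoin[OF L _ _, of p p y y] p unfolding M_eq by (simp add: is_min_poly_def)
  have LM: "L \<subseteq> M" using adjoin_supset[OF L, of y y] unfolding M_eq by auto
  have "y \<in> M" using adjoin_generator[OF L, of y y] unfolding M_eq by auto
  then have algM: "algebraic_over_subfield M z"
    using algebraic_over_subfield_mono[OF alg gen_subfield_subset[OF hom]] LM by blast
  have "\<exists>\<sigma>. field_hom \<sigma> \<and> (\<forall>a\<in>L. \<sigma> a = a) \<and> \<sigma> z \<noteq> z"
  proof (cases "z \<in> M")
    case True
    then obtain q where "z = poly q y" "\<And>i. coeff q i \<in> L" unfolding M_def by blast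
    then show ?thesis using step[OF L subset_refl p, of q] \<open>z \<notin> L\<close> by blast
  next
    case False
    obtain p' where p': "is_min_poly M z p'" using min_poly_exists[OF algM] by blast
    have "coeff (monom 1 1) i \<in> M" for i
      using partial_homD(1)[OF hom] partial_hom_zero[OF hom] by auto
    then show ?thesis using step[OF hom LM p', of "monom 1 1"] False by (auto simp: poly_monom)
  qed
  then show False using fixed by blast
qed

section \<open>The kernel polynomial\<close>

lemma poly_map_poly:
  fixes f :: "'a::zero \<Rightarrow> 'b::comm_ring_1"
  assumes "f 0 = 0"
  shows "poly (map_poly f p) x = (\<Sum>i\<le>degree p. f (coeff p i) * x ^ i)"
proof -
  have "poly (map_poly f p) x = (\<Sum>i\<le>degree (map_poly f p). f (coeff p i) * x ^ i)"
    by (simp add: poly_altdef coeff_map_poly assms)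
  also have "\<dots> = (\<Sum>i\<le>degree p. f (coeff p i) * x ^ i)"
  proof (rule sum.mono_neutral_left)
    show "\<forall>i\<in>{..degree p} - {..degree (map_poly f p)}. f (coeff p i) * x ^ i = 0"
      using coeff_eq_0[of "map_poly f p"] by (auto simp: coeff_map_poly assms)
  qed (use map_poly_degree_leq in auto)
  finally show ?thesis .
qed

lemma poly_map_poly_add:
  assumes "f 0 = 0" "\<And>a b. f (a + b) = f a + f b"
  shows "poly (map_poly f (p + q)) x = poly (map_poly f p) x + poly (map_poly f q) x"
proof -
  have "map_poly f (p + q) = map_poly f p + map_poly f q"
    by (rule poly_eqI) (simp add: coeff_map_poly assms)
  then show ?thesis by simp
qed

lemma poly_map_poly_mult:
  fixes f :: "'a::comm_ring_1 \<Rightarrow> 'b::comm_ring_1"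
  assumes "f 0 = 0" "\<And>a b. f (a + b) = f a + f b" "\<And>a b. f (a * b) = f a * f b"
  shows "poly (map_poly f (p * q)) x = poly (map_poly f p) x * poly (map_poly f q) x"
proof (induction p)
  case (pCons a p)
  have "map_poly f (smult a q) = smult (f a) (map_poly f q)"
    by (rule poly_eqI) (simp add: coeff_map_poly assms)
  then show ?case
    using pCons by (simp add: poly_map_poly_add[of f, OF assms(1,2)] map_poly_pCons assms(1) algebra_simps)
qed simp

lemma field_embeddingD:
  assumes "field_embedding \<iota>"
  shows "\<iota> 1 = 1" "\<iota> (a + b) = \<iota> a + \<iota> b" "\<iota> (a * b) = \<iota> a * \<iota> b" "\<iota> 0 = 0" "\<iota> (- a) = - \<iota> a"
    "\<iota> (a - b) = \<iota> a - \<iota> b" "\<iota> a = 0 \<longleftrightarrow> a = 0" "\<iota> (of_nat n) = of_nat n"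
proof -
  show 1: "\<iota> 1 = 1" and add: "\<iota> (a + b) = \<iota> a + \<iota> b" and mult: "\<iota> (a * b) = \<iota> a * \<iota> b" for a b
    using assms unfolding field_embedding_def by blast+
  show 0: "\<iota> 0 = 0" using add[of 0 0] by (metis add.right_neutral add_cancel_right_right)
  show m: "\<iota> (- a) = - \<iota> a" for a using add[of a "- a"] 0 by (simp add: eq_neg_iff_add_eq_0 add.commute)
  show "\<iota> (a - b) = \<iota> a - \<iota> b" using add[of a "- b"] m by simp
  show "\<iota> a = 0 \<longleftrightarrow> a = 0"
  proof
    assume "\<iota> a = 0"
    then have "\<iota> (a * inverse a) = 0" using mult[of a "inverse a"] by simp
    then show "a = 0" using 1 by (cases "a = 0") auto
  qed (use 0 in simp)
  show "\<iota> (of_nat n) = of_nat n" by (induction n) (simp_all add: 0 1 add)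
qed

lemma field_embedding_inverse:
  assumes "field_embedding \<iota>" shows "\<iota> (inverse a) = inverse (\<iota> a)"
proof (cases "a = 0")
  case False
  then have "\<iota> a * \<iota> (inverse a) = 1"
    using field_embeddingD(1,3)[OF assms] by (metis right_inverse)
  then show ?thesis by (metis inverse_unique)
qed (simp add: field_embeddingD(4)[OF assms])

lemma eval_XY_hom:
  assumes "field_embedding \<iota>"
  shows "eval_XY \<iota> 0 u v = 0" "eval_XY \<iota> 1 u v = 1"
    "eval_XY \<iota> (P + Q) u v = eval_XY \<iota> P u v + eval_XY \<iota> Q u v"
    "eval_XY \<iota> (P * Q) u v = eval_XY \<iota> P u v * eval_XY \<iota> Q u v"
    "eval_XY \<iota> (- P) u v = - eval_XY \<iota> P u v"
    "eval_XY \<iota> (P - Q) u v = eval_XY \<iota> P u v - eval_XY \<iota> Q u v"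
    "eval_XY \<iota> (P ^ n) u v = eval_XY \<iota> P u v ^ n"
    "eval_XY \<iota> (\<Sum>i\<in>I. F i) u v = (\<Sum>i\<in>I. eval_XY \<iota> (F i) u v)"
    "eval_XY \<iota> (monom (monom c i) j) u v = \<iota> c * u ^ i * v ^ j"
    "eval_XY \<iota> [:q:] u v = poly (map_poly \<iota> q) u"
proof -
  note \<iota> = field_embeddingD[OF assms]
  have in_add: "poly (map_poly \<iota> (p + q)) u = poly (map_poly \<iota> p) u + poly (map_poly \<iota> q) u" for p q
    by (rule poly_map_poly_add) (simp_all add: \<iota>)
  have in_mult: "poly (map_poly \<iota> (p * q)) u = poly (map_poly \<iota> p) u * poly (map_poly \<iota> q) u" for p q
    by (rule poly_map_poly_mult) (simp_all add: \<iota>)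
  show 0: "eval_XY \<iota> 0 u v = 0" by (simp add: eval_XY_def)
  show 1: "eval_XY \<iota> 1 u v = 1" by (simp add: eval_XY_def \<iota>)
  show add: "eval_XY \<iota> (P + Q) u v = eval_XY \<iota> P u v + eval_XY \<iota> Q u v" for P Q
    unfolding eval_XY_def by (rule poly_map_poly_add) (simp_all add: in_add)
  show mult: "eval_XY \<iota> (P * Q) u v = eval_XY \<iota> P u v * eval_XY \<iota> Q u v" for P Q
    unfolding eval_XY_def by (rule poly_map_poly_mult) (simp_all add: in_add in_mult)
  show m: "eval_XY \<iota> (- P) u v = - eval_XY \<iota> P u v" for P
    using add[of P "- P"] 0 by (simp add: eq_neg_iff_add_eq_0 add.commute)
  show "eval_XY \<iota> (P - Q) u v = eval_XY \<iota> P u v - eval_XY \<iota> Q u v"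
    using add[of P "- Q"] m by simp
  show "eval_XY \<iota> (P ^ n) u v = eval_XY \<iota> P u v ^ n" by (induction n) (simp_all add: 1 mult)
  show "eval_XY \<iota> (\<Sum>i\<in>I. F i) u v = (\<Sum>i\<in>I. eval_XY \<iota> (F i) u v)"
    by (induction I rule: infinite_finite_induct) (simp_all add: 0 add)
  show "eval_XY \<iota> (monom (monom c i) j) u v = \<iota> c * u ^ i * v ^ j"
    unfolding eval_XY_def by (simp add: map_poly_monom poly_monom \<iota>)
  show "eval_XY \<iota> [:q:] u v = poly (map_poly \<iota> q) u"
    unfolding eval_XY_def by (simp add: map_poly_pCons)
qed

lemma eval_XYt_hom:
  assumes "field_embedding \<iota>"
  shows "eval_XYt \<iota> 0 u v t = 0" 
    "eval_XYt \<iota> (P + Q) u v t = eval_XYt \<iota> P u v t + eval_XYt \<iota> Q u v t"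
    "eval_XYt \<iota> (P * Q) u v t = eval_XYt \<iota> P u v t * eval_XYt \<iota> Q u v t"
    "eval_XYt \<iota> [:p:] u v t = eval_XY \<iota> p u v"
    "eval_XYt \<iota> (\<Sum>i\<in>I. F i) u v t = (\<Sum>i\<in>I. eval_XYt \<iota> (F i) u v t)"
proof -
  note h = eval_XY_hom[OF assms]
  show 0: "eval_XYt \<iota> 0 u v t = 0" by (simp add: eval_XYt_def)
  show add: "eval_XYt \<iota> (P + Q) u v t = eval_XYt \<iota> P u v t + eval_XYt \<iota> Q u v t" for P Q
    unfolding eval_XYt_def by (rule poly_map_poly_add) (simp_all add: h)
  show "eval_XYt \<iota> (P * Q) u v t = eval_XYt \<iota> P u v t * eval_XYt \<iota> Q u v t"
    unfolding eval_XYt_def by (rule poly_map_poly_mult) (simp_all add: h)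
  show "eval_XYt \<iota> [:p:] u v t = eval_XY \<iota> p u v"
    unfolding eval_XYt_def by (simp add: map_poly_pCons h)
  show "eval_XYt \<iota> (\<Sum>i\<in>I. F i) u v t = (\<Sum>i\<in>I. eval_XYt \<iota> (F i) u v t)"
    by (induction I rule: infinite_finite_induct) (simp_all add: 0 add)
qed

lemma eval_XYt_altdef:
  assumes "field_embedding \<iota>"
  shows "eval_XYt \<iota> D u v t = (\<Sum>j\<le>degree D. eval_XY \<iota> (coeff D j) u v * t ^ j)"
  unfolding eval_XYt_def by (rule poly_map_poly) (simp add: eval_XY_hom[OF assms])

text \<open>For \<open>i = 0\<close> this evaluates the embedding of C[X,t]; general
  \<open>i\<close> allows a polynomial in Y with coefficients in C[X,t] to be assembled term by
  term, as in \<open>Kx_degree_bound\<close>.\<close>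

lemma eval_XYt_embed_Xt:
  "eval_XYt \<iota> (map_poly (\<lambda>q. monom q i) A) u v t = eval_XY \<iota> A u t * v ^ i"
proof -
  have "(\<lambda>Q. eval_XY \<iota> Q u v) \<circ> (\<lambda>q. monom q i) = (\<lambda>q. poly (map_poly \<iota> q) u * v ^ i)"
    by (auto simp: eval_XY_def map_poly_monom poly_monom)
  then have "eval_XYt \<iota> (map_poly (\<lambda>q. monom q i) A) u v t
      = poly (map_poly (\<lambda>q. poly (map_poly \<iota> q) u * v ^ i) A) t"
    unfolding eval_XYt_def by (subst map_poly_map_poly) (auto simp: eval_XY_def)
  then show ?thesis
    unfolding eval_XY_def
    by (simp add: poly_map_poly sum_distrib_left mult_ac)
qed

lemma eval_XYt_embed_Yt:
  assumes "field_embedding \<iota>"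
  shows "eval_XYt \<iota> (map_poly (map_poly (\<lambda>c. [:c:])) A) u v t = eval_XY \<iota> A v t"
proof -
  have "(\<lambda>q. poly (map_poly \<iota> q) u) \<circ> (\<lambda>c. [:c:]) = \<iota>"
    using field_embeddingD(4)[OF assms] by (auto simp: map_poly_pCons)
  then have "(\<lambda>Q. eval_XY \<iota> Q u v) \<circ> map_poly (\<lambda>c. [:c:]) = (\<lambda>q. poly (map_poly \<iota> q) v)"
    by (auto simp: eval_XY_def map_poly_map_poly)
  then show ?thesis
    unfolding eval_XYt_def by (subst map_poly_map_poly) (auto simp: eval_XY_def)
qed

lemma partial_hom_eval_XY:
  assumes G: "partial_hom G" and \<iota>: "field_embedding \<iota>" "\<And>c. (\<iota> c, \<iota> c) \<in> G"
    and "(a, u) \<in> G" "(b, v) \<in> G"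
  shows "(eval_XY \<iota> P a b, eval_XY \<iota> P u v) \<in> G"
proof -
  have \<iota>0: "\<iota> 0 = 0" by (rule field_embeddingD(4)[OF \<iota>(1)])
  have "(poly (map_poly \<iota> q) a, poly (map_poly \<iota> q) u) \<in> G" for q
    unfolding poly_map_poly[of \<iota>, OF \<iota>0]
    by (intro partial_hom_sum partial_homD(3) partial_hom_power G \<iota> assms)
  then show ?thesis
    unfolding eval_XY_def
    by (subst (1 2) poly_map_poly) (auto intro!: partial_hom_sum partial_homD(3) partial_hom_power G assms)
qed

lemma partial_hom_eval_XYt:
  assumes G: "partial_hom G" and \<iota>: "field_embedding \<iota>" "\<And>c. (\<iota> c, \<iota> c) \<in> G"
    and "(a, u) \<in> G" "(b, v) \<in> G" "(s, t) \<in> G"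
  shows "(eval_XYt \<iota> P a b s, eval_XYt \<iota> P u v t) \<in> G"
  unfolding eval_XYt_altdef[OF \<iota>(1)]
  by (intro partial_hom_sum partial_homD(3) partial_hom_power partial_hom_eval_XY G assms)

lemma prime_elem_X: "prime_elem [:0, 1 :: 'a::idom:]"
proof -
  have "[:0, 1:] dvd c \<longleftrightarrow> poly c 0 = 0" for c :: "'a poly"
    using poly_eq_0_iff_dvd[of c 0] by simp
  then show ?thesis by (intro prime_elemI) auto
qed

text \<open>The two conditions say that neither of the primes Y and X divides \<open>N\<close>, and
  the monomial is a product of powers of these primes.\<close>

lemma coprime_monom_monom:
  fixes N :: "complex poly poly"
  assumes "coeff N 0 \<noteq> 0" "coeff (coeff N b) 0 \<noteq> 0"
  shows "coprime (monom (monom 1 i) j) N"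
proof -
  have X: "[:0, 1:] dvd c \<longleftrightarrow> coeff c 0 = 0" for c :: "'a::idom poly"
    using poly_eq_0_iff_dvd[of c 0] by (simp add: poly_0_coeff_0)
  have "coprime [:0, 1:] N"
    using assms(1) by (intro prime_elem_imp_coprime prime_elem_X) (simp add: X)
  moreover have "coprime [:[:0, 1:]:] N"
    using assms(2) by (intro prime_elem_imp_coprime lift_prime_elem_poly prime_elem_X)
      (auto simp: const_poly_dvd_iff X)
  moreover have "monom (monom 1 i) j = [:[:0, 1 :: complex:]:] ^ i * [:0, 1:] ^ j"
    by (simp add: monom_altdef poly_const_pow)
  ultimately show ?thesis by simp
qed

section \<open>Arithmetic of the kernel\<close>

locale walk_kernel =
  fixes \<S> :: "(int \<times> int) set" and w :: "int \<times> int \<Rightarrow> complex"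
    and \<iota> :: "complex \<Rightarrow> 'k::field" and x y :: 'k
  assumes finite_steps: "finite \<S>" and steps_nonempty: "\<S> \<noteq> {}"
    and weights: "\<And>a. a \<in> \<S> \<Longrightarrow> w a \<noteq> 0"
    and m_x_pos: "m_x \<S> > 0" and M_x_pos: "M_x \<S> > 0" and m_y_pos: "m_y \<S> > 0" and M_y_pos: "M_y \<S> > 0"
    and emb: "field_embedding \<iota>" and indep: "alg_indep2 \<iota> x y"
begin

abbreviation s :: 'k where "s \<equiv> step_value \<S> w \<iota> x y"

text \<open>\<open>N = X\<^sup>m\<^sup>x Y\<^sup>m\<^sup>y S(X, Y)\<close>, so that the kernel is \<open>X\<^sup>m\<^sup>x Y\<^sup>m\<^sup>y - t N\<close>.\<close>

definition N :: "complex poly poly" where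
  "N = (\<Sum>(i, j)\<in>\<S>. monom (monom (w (i, j)) (nat (i + m_x \<S>))) (nat (j + m_y \<S>)))"

lemma exponents_bounds:
  assumes "(i, j) \<in> \<S>"
  shows "i + m_x \<S> \<ge> 0" "j + m_y \<S> \<ge> 0" "j \<le> M_y \<S>"
proof -
  have "Min (fst ` \<S>) \<le> i" "Min (snd ` \<S>) \<le> j" "j \<le> Max (snd ` \<S>)"
    using finite_steps assms by (force intro!: Min_le Max_ge)+
  then show "i + m_x \<S> \<ge> 0" "j + m_y \<S> \<ge> 0" "j \<le> M_y \<S>"
    unfolding m_x_def m_y_def M_y_def by simp_all
qed

lemma coeff_N:
  "coeff (coeff N b) a =
     (if (int a - m_x \<S>, int b - m_y \<S>) \<in> \<S> then w (int a - m_x \<S>, int b - m_y \<S>) else 0)"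
proof -
  have "coeff (coeff N b) a = (\<Sum>(i, j)\<in>\<S>. coeff (coeff (monom (monom (w (i, j)) (nat (i + m_x \<S>))) (nat (j + m_y \<S>))) b) a)"
    unfolding N_def coeff_sum by (auto intro!: sum.cong)
  also have "\<dots> = (\<Sum>e\<in>\<S>. if e = (int a - m_x \<S>, int b - m_y \<S>) then w e else 0)"
  proof (rule sum.cong[OF refl], clarify)
    fix i j assume "(i, j) \<in> \<S>"
    then have "i + m_x \<S> \<ge> 0" "j + m_y \<S> \<ge> 0" using exponents_bounds by auto
    then show "coeff (coeff (monom (monom (w (i, j)) (nat (i + m_x \<S>))) (nat (j + m_y \<S>))) b) a =
       (if (i, j) = (int a - m_x \<S>, int b - m_y \<S>) then w (i, j) else 0)"
      by (auto simp: coeff_monom)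
  qed
  also have "\<dots> = (if (int a - m_x \<S>, int b - m_y \<S>) \<in> \<S> then w (int a - m_x \<S>, int b - m_y \<S>) else 0)"
    using finite_steps by (simp add: sum.delta')
  finally show ?thesis .
qed

lemma coeff_N_step:
  assumes "(i, j) \<in> \<S>"
  shows "coeff (coeff N (nat (j + m_y \<S>))) (nat (i + m_x \<S>)) \<noteq> 0"
  using exponents_bounds[OF assms] assms weights[OF assms] by (simp add: coeff_N)

lemma extremal_steps:
  shows "\<exists>j. (- m_x \<S>, j) \<in> \<S>" "\<exists>i. (i, - m_y \<S>) \<in> \<S>" "\<exists>i. (i, M_y \<S>) \<in> \<S>"
proof -
  have "Min (fst ` \<S>) \<in> fst ` \<S>" "Min (snd ` \<S>) \<in> snd ` \<S>" "Max (snd ` \<S>) \<in> snd ` \<S>"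
    using finite_steps steps_nonempty by (auto intro!: Min_in Max_in)
  then show "\<exists>j. (- m_x \<S>, j) \<in> \<S>" "\<exists>i. (i, - m_y \<S>) \<in> \<S>" "\<exists>i. (i, M_y \<S>) \<in> \<S>"
    unfolding m_x_def m_y_def M_y_def by force+
qed

lemma degree_N: "degree N = nat (m_y \<S> + M_y \<S>)"
proof (rule antisym)
  show "degree N \<le> nat (m_y \<S> + M_y \<S>)"
  proof (rule degree_le, intro allI impI)
    fix b assume b: "nat (m_y \<S> + M_y \<S>) < b"
    have "(int a - m_x \<S>, int b - m_y \<S>) \<notin> \<S>" for a
      using exponents_bounds(3)[of "int a - m_x \<S>" "int b - m_y \<S>"] b by linarith
    then show "coeff N b = 0" by (intro poly_eqI) (simp add: coeff_N)
  qed
  obtain i where "(i, M_y \<S>) \<in> \<S>" using extremal_steps(3) by blast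
  from coeff_N_step[OF this] show "nat (m_y \<S> + M_y \<S>) \<le> degree N"
    by (intro le_degree) (auto simp: add.commute)
qed

text \<open>Because the largest Y-exponent of a step is positive, the part of the kernel free of t
  has smaller Y-degree than \<open>N\<close>. So the leading term in Y comes from
  \<open>N\<close>.\<close>

lemma m_y_less_degree_N: "nat (m_y \<S>) < degree N"
  using m_y_pos M_y_pos unfolding degree_N by simp

lemma N_nonzero: "N \<noteq> 0" using m_y_less_degree_N by auto

text \<open>A step with smallest X-exponent gives a monomial of \<open>N\<close> without X, and a
  step with smallest Y-exponent gives one without Y.\<close>

lemma coprime_N: "coprime (monom (monom 1 i) j) N"
proof -
  obtain b where b: "(- m_x \<S>, b) \<in> \<S>" using extremal_steps(1) by blast
  obtain a where a: "(a, - m_y \<S>) \<in> \<S>" using extremal_steps(2) by blast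
  show ?thesis
    using coeff_N_step[OF b] coeff_N_step[OF a]
    by (intro coprime_monom_monom[of _ "nat (b + m_y \<S>)"]) auto
qed

lemma eval_nonzero: "P \<noteq> 0 \<Longrightarrow> eval_XY \<iota> P x y \<noteq> 0"
  using indep unfolding alg_indep2_def by blast

lemma x_nonzero: "x \<noteq> 0" and y_nonzero: "y \<noteq> 0"
proof -
  show "x \<noteq> 0" using eval_nonzero[of "monom (monom 1 1) 0"] unfolding eval_XY_hom(9)[OF emb] by auto
  show "y \<noteq> 0" using eval_nonzero[of "monom (monom 1 0) 1"] unfolding eval_XY_hom(9)[OF emb] by auto
qed

lemma eval_N:
  assumes "u \<noteq> 0" "v \<noteq> 0"
  shows "eval_XY \<iota> N u v = u ^ nat (m_x \<S>) * v ^ nat (m_y \<S>) * step_value \<S> w \<iota> u v"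
proof -
  have pow: "z ^ nat (i + m) = z ^ nat m * z powi i" if "i + m \<ge> 0" "m > 0" "z \<noteq> 0" for z :: 'k and i m
  proof -
    have "z ^ nat (i + m) = z powi (i + m)" using that by (simp add: power_int_def)
    also have "\<dots> = z powi i * z powi m" using that by (simp add: power_int_add)
    also have "z powi m = z ^ nat m" using that by (simp add: power_int_def)
    finally show ?thesis by (simp add: mult.commute)
  qed
  have "eval_XY \<iota> N u v = (\<Sum>(i, j)\<in>\<S>. \<iota> (w (i, j)) * u ^ nat (i + m_x \<S>) * v ^ nat (j + m_y \<S>))"
    unfolding N_def by (simp add: eval_XY_hom[OF emb] case_prod_beta)
  also have "\<dots> = (\<Sum>(i, j)\<in>\<S>. u ^ nat (m_x \<S>) * v ^ nat (m_y \<S>) * (\<iota> (w (i, j)) * u powi i * v powi j))"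
    using exponents_bounds m_x_pos m_y_pos assms
    by (intro sum.cong refl) (auto simp: pow mult_ac)
  also have "\<dots> = u ^ nat (m_x \<S>) * v ^ nat (m_y \<S>) * step_value \<S> w \<iota> u v"
    unfolding step_value_def by (simp add: sum_distrib_left case_prod_beta)
  finally show ?thesis .
qed

lemma s_nonzero: "s \<noteq> 0"
  using eval_nonzero[OF N_nonzero] eval_N[OF x_nonzero y_nonzero] by auto

lemma kernel_poly_eq: "kernel_poly \<S> w = [:monom (monom 1 (nat (m_x \<S>))) (nat (m_y \<S>)), - N:]"
  unfolding kernel_poly_def N_def ..

lemma eval_kernel_poly:
  assumes "u \<noteq> 0" "v \<noteq> 0" "step_value \<S> w \<iota> u v = s"
  shows "eval_XYt \<iota> (kernel_poly \<S> w) u v (1 / s) = 0"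
  unfolding kernel_poly_eq eval_XYt_def
  using s_nonzero by (simp add: map_poly_pCons eval_XY_hom[OF emb] eval_N assms field_embeddingD[OF emb])

text \<open>Clearing denominators in \<open>D(x, y, 1/s) = 0\<close> gives, by algebraic independence, the polynomial
  identity \<open>E = 0\<close> below, all terms of which except the last are divisible by \<open>N\<close>.\<close>

lemma N_dvd_lead_coeff:
  assumes "eval_XYt \<iota> D x y (1 / s) = 0" "degree D > 0"
  shows "N dvd lead_coeff D"
proof -
  define a where "a = (monom (monom 1 (nat (m_x \<S>))) (nat (m_y \<S>)) :: complex poly poly)"
  define n where "n = degree D"
  define E where "E = (\<Sum>j\<le>n. coeff D j * a ^ j * N ^ (n - j))"
  let ?a = "eval_XY \<iota> a x y" let ?N = "eval_XY \<iota> N x y"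
  have "?a = x ^ nat (m_x \<S>) * y ^ nat (m_y \<S>)"
    by (simp add: a_def eval_XY_hom[OF emb] field_embeddingD[OF emb])
  then have Na: "?N = ?a * s" using eval_N[OF x_nonzero y_nonzero] by simp
  have N0: "?N \<noteq> 0" by (rule eval_nonzero[OF N_nonzero])
  have "?a ^ j * ?N ^ (n - j) = ?N ^ n * (1 / s) ^ j" if "j \<le> n" for j
  proof -
    have "?N ^ n = ?N ^ j * ?N ^ (n - j)" using that by (simp flip: power_add)
    moreover have "?N ^ j * (1 / s) ^ j = ?a ^ j"
      using s_nonzero by (simp add: Na flip: power_mult_distrib)
    ultimately show ?thesis by (simp add: mult_ac)
  qed
  then have "eval_XY \<iota> E x y = (\<Sum>j\<le>n. ?N ^ n * (eval_XY \<iota> (coeff D j) x y * (1 / s) ^ j))"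
    unfolding E_def eval_XY_hom[OF emb]
    by (intro sum.cong refl) (simp add: mult.assoc mult.left_commute)
  also have "\<dots> = ?N ^ n * eval_XYt \<iota> D x y (1 / s)"
    by (simp add: eval_XYt_altdef[OF emb] n_def sum_distrib_left)
  finally have "E = 0" using assms(1) eval_nonzero by fastforce
  have "N dvd (\<Sum>j<n. coeff D j * a ^ j * N ^ (n - j))"
    by (rule dvd_sum) (auto intro!: dvd_mult dvd_power)
  moreover have "E = (\<Sum>j<n. coeff D j * a ^ j * N ^ (n - j)) + coeff D n * a ^ n"
    unfolding E_def by (simp add: lessThan_Suc_atMost[symmetric])
  ultimately have "N dvd coeff D n * a ^ n"
    using \<open>E = 0\<close>
    dvd_add_right_iff[of N "\<Sum>j<n. coeff D j * a ^ j * N ^ (n - j)" "coeff D n * a ^ n"] by simp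
  moreover have "coprime N (a ^ n)"
    using coprime_N unfolding a_def by (simp add: coprime_commute)
  ultimately show ?thesis unfolding n_def by (simp add: coprime_dvd_mult_left_iff)
qed

text \<open>Since \<open>N\<close> divides the leading coefficient, the kernel can be divided off without denominators.\<close>

lemma kernel_poly_dvd:
  assumes "eval_XYt \<iota> D x y (1 / s) = 0"
  shows "kernel_poly \<S> w dvd D"
  using assms
proof (induction "degree D" arbitrary: D rule: less_induct)
  case less
  show ?case
  proof (cases "degree D = 0")
    case True
    then obtain c where c: "D = [:c:]" by (auto elim: degree_eq_zeroE)
    then show ?thesis
      using less(2) eval_nonzero[of c] by (cases "c = 0") (auto simp: eval_XYt_hom[OF emb])
  next
    case False
    then obtain q where q: "lead_coeff D = N * q" using N_dvd_lead_coeff[OF less(2)] by (auto elim: dvdE)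
    \<comment> \<open>The kernel has t-coefficient \<open>- N\<close>, so this multiple of it
      cancels the leading term \<open>N * q\<close> of \<open>D\<close> in t.\<close>
    define D' where "D' = D + kernel_poly \<S> w * monom q (degree D - 1)"
    have deg: "degree (kernel_poly \<S> w) = 1" using N_nonzero by (simp add: kernel_poly_eq)
    have "degree (kernel_poly \<S> w * monom q (degree D - 1)) \<le> degree D"
      using degree_mult_le[of "kernel_poly \<S> w" "monom q (degree D - 1)"]
        degree_monom_le[of q "degree D - 1"] deg False by linarith
    then have "degree D' \<le> degree D" unfolding D'_def by (simp add: degree_add_le)
    moreover have "coeff D' (degree D) = 0"
    proof -
      have "coeff (kernel_poly \<S> w * monom q (degree D - 1)) (degree D) = - N * q"
        using False by (cases "degree D") (simp_all add: mult.commute[of "kernel_poly \<S> w"] coeff_monom_mult,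
          simp add: kernel_poly_eq)
      then show ?thesis by (simp add: D'_def q)
    qed
    moreover have "eval_XYt \<iota> D' x y (1 / s) = 0"
      unfolding D'_def using less(2) eval_kernel_poly[OF x_nonzero y_nonzero]
      by (simp add: eval_XYt_hom[OF emb])
    ultimately have "kernel_poly \<S> w dvd D'"
      using less(1)[of D'] eq_zero_or_degree_less[of D' "degree D"] by auto
    then show ?thesis unfolding D'_def by (simp add: dvd_add_left_iff)
  qed
qed

text \<open>A zero would make \<open>N\<close> divide the leading coefficient of \<open>D\<close> in
  t, whose Y-degree is too small. In substance, the powers of y below the degree of \<open>N\<close>
  are linearly independent over k(x).\<close>

lemma eval_XYt_nonzero:
  assumes "D \<noteq> 0" "\<And>j. degree (coeff D j) < degree N"
  shows "eval_XYt \<iota> D x y (1 / s) \<noteq> 0"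
proof
  assume ev: "eval_XYt \<iota> D x y (1 / s) = 0"
  show False
  proof (cases "degree D = 0")
    case True
    then obtain c where c: "D = [:c:]" by (auto elim: degree_eq_zeroE)
    then show ?thesis using ev eval_nonzero[of c] assms(1) by (auto simp: eval_XYt_hom[OF emb])
  next
    case False
    then have "degree N \<le> degree (lead_coeff D)"
      using N_dvd_lead_coeff[OF ev] assms(1) by (simp add: dvd_imp_degree_le)
    then show False using assms(2)[of "degree D"] by simp
  qed
qed

text \<open>Thus x and \<open>s\<close> are algebraically independent: with its outer variable read
  as t, \<open>B\<close> embeds in C[X,Y,t] with Y-degree 0, below that of \<open>N\<close>.\<close>

lemma eval_Xt_nonzero:
  assumes "B \<noteq> 0" shows "eval_XY \<iota> B x (1 / s) \<noteq> 0"
proof -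
  have "map_poly (\<lambda>q. monom q 0) B \<noteq> 0"
    using assms by (subst map_poly_eq_0_iff) auto
  then have "eval_XYt \<iota> (map_poly (\<lambda>q. monom q 0) B) x y (1 / s) \<noteq> 0"
    using m_y_less_degree_N by (intro eval_XYt_nonzero) (auto simp: coeff_map_poly monom_0)
  then show ?thesis by (simp add: eval_XYt_embed_Xt)
qed

section \<open>The minimal polynomial of y over k(x)\<close>

definition K\<^sub>x :: "'k set" where "K\<^sub>x = gen_subfield (base_field \<S> w \<iota> x y \<union> {x})"

lemma partial_hom_Kx: "partial_hom (Id_on K\<^sub>x)"
  unfolding K\<^sub>x_def by (rule partial_hom_Id_on_gen_subfield)

lemma Kx_generators: "\<iota> c \<in> K\<^sub>x" "s \<in> K\<^sub>x" "x \<in> K\<^sub>x"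
  unfolding K\<^sub>x_def base_field_def by (auto intro!: gen_subfield.base)

text \<open>Fractions in x and 1/s form a subfield containing the generators of k(x). This form
  leads back to C[X,Y,t], where divisibility by \<open>N\<close> can be used.\<close>

lemma Kx_fraction:
  assumes "a \<in> K\<^sub>x"
  shows "\<exists>A B. eval_XY \<iota> B x (1 / s) \<noteq> 0 \<and> a = eval_XY \<iota> A x (1 / s) / eval_XY \<iota> B x (1 / s)"
proof -
  define F where "F = {eval_XY \<iota> A x (1 / s) / eval_XY \<iota> B x (1 / s) | A B. eval_XY \<iota> B x (1 / s) \<noteq> 0}"
  note h = eval_XY_hom[OF emb]
  have FI: "eval_XY \<iota> A x (1 / s) / eval_XY \<iota> B x (1 / s) \<in> F" if "eval_XY \<iota> B x (1 / s) \<noteq> 0" for A B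
    unfolding F_def using that by blast
  have pol: "eval_XY \<iota> A x (1 / s) \<in> F" for A using FI[of 1 A] by (simp add: h)
  have hom: "partial_hom (Id_on F)"
    unfolding partial_hom_def Id_on_iff
  proof (intro conjI allI impI; (elim conjE)?)
    show "1 \<in> F" using pol[of 1] by (simp add: h)
    fix a c assume "a \<in> F" "c \<in> F"
    then obtain A B C D where AB: "eval_XY \<iota> B x (1 / s) \<noteq> 0" "a = eval_XY \<iota> A x (1 / s) / eval_XY \<iota> B x (1 / s)"
      and CD: "eval_XY \<iota> D x (1 / s) \<noteq> 0" "c = eval_XY \<iota> C x (1 / s) / eval_XY \<iota> D x (1 / s)"
      unfolding F_def by auto
    show "a - c \<in> F"
      using FI[of "B * D" "A * D - C * B"] AB CD by (simp add: h diff_frac_eq mult.commute)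
    show "a * c \<in> F"
      using FI[of "B * D" "A * C"] AB CD by (simp add: h)
  next
    fix a assume "a \<in> F"
    then obtain A B where AB: "eval_XY \<iota> B x (1 / s) \<noteq> 0" "a = eval_XY \<iota> A x (1 / s) / eval_XY \<iota> B x (1 / s)"
      unfolding F_def by auto
    show "inverse a \<in> F"
    proof (cases "eval_XY \<iota> A x (1 / s) = 0")
      case True
      then show ?thesis using AB pol[of 0] by (simp add: h)
    next
      case False
      then show ?thesis using AB FI[of A B] by simp
    qed
  qed auto
  \<comment> \<open>\<open>s\<close> is the fraction with numerator 1 whose denominator is the outer
    variable, evaluated at 1/s.\<close>
  have s: "s \<in> F"
    using FI[of "monom (monom 1 0) 1" 1] s_nonzero unfolding h(9)
    by (simp add: h field_embeddingD[OF emb])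
  have \<iota>: "\<iota> c \<in> F" for c using pol[of "monom (monom c 0) 0"] by (simp add: h)
  have xF: "x \<in> F" using pol[of "monom (monom 1 1) 0"] by (simp add: h field_embeddingD[OF emb])
  have "base_field \<S> w \<iota> x y \<subseteq> F"
    unfolding base_field_def using s \<iota> by (intro gen_subfield_subset[OF hom]) auto
  then have "K\<^sub>x \<subseteq> F"
    unfolding K\<^sub>x_def using xF by (intro gen_subfield_subset[OF hom]) auto
  then show ?thesis using assms unfolding F_def by blast
qed

lemma Kx_clear_denominators:
  assumes "\<And>i. coeff q i \<in> K\<^sub>x"
  shows "\<exists>C A. eval_XY \<iota> C x (1 / s) \<noteq> 0 \<and> (\<forall>i. eval_XY \<iota> C x (1 / s) * coeff q i = eval_XY \<iota> (A i) x (1 / s))"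
  using assms
proof (induction q)
  case 0
  show ?case by (rule exI[of _ 1], rule exI[of _ "\<lambda>_. 0"]) (simp add: eval_XY_hom[OF emb])
next
  case (pCons a q)
  have "coeff q i \<in> K\<^sub>x" for i using pCons(3)[of "Suc i"] by simp
  then obtain C A where CA: "eval_XY \<iota> C x (1 / s) \<noteq> 0"
      "\<And>i. eval_XY \<iota> C x (1 / s) * coeff q i = eval_XY \<iota> (A i) x (1 / s)"
    using pCons(2) by blast
  obtain P B where PB: "eval_XY \<iota> B x (1 / s) \<noteq> 0" "a = eval_XY \<iota> P x (1 / s) / eval_XY \<iota> B x (1 / s)"
    using Kx_fraction[of a] pCons(3)[of 0] by auto
  show ?case
    by (rule exI[of _ "B * C"], rule exI[of _ "\<lambda>i. case i of 0 \<Rightarrow> C * P | Suc i \<Rightarrow> B * A i"])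
       (use CA PB in \<open>auto simp: eval_XY_hom[OF emb] coeff_pCons split: nat.splits\<close>)
qed

text \<open>Clearing denominators turns \<open>q\<close> into a nonzero \<open>D\<close> in
  C[X,Y,t], the variable of \<open>q\<close> becoming Y, with D(x, y, 1/s) = 0. If \<open>q\<close>
  had smaller degree than \<open>N\<close>, this would contradict
  \<open>eval_XYt_nonzero\<close>.\<close>

lemma Kx_degree_bound:
  assumes "q \<noteq> 0" "\<And>i. coeff q i \<in> K\<^sub>x" "poly q y = 0"
  shows "degree N \<le> degree q"
proof (rule ccontr)
  assume less: "\<not> degree N \<le> degree q"
  obtain C A where CA: "eval_XY \<iota> C x (1 / s) \<noteq> 0"
      "\<And>i. eval_XY \<iota> C x (1 / s) * coeff q i = eval_XY \<iota> (A i) x (1 / s)"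
    using Kx_clear_denominators[OF assms(2)] by blast
  define D where "D = (\<Sum>i\<le>degree q. map_poly (\<lambda>c. monom c i) (A i))"
  have cD: "coeff D j = (\<Sum>i\<le>degree q. monom (coeff (A i) j) i)" for j
    unfolding D_def by (simp add: coeff_sum coeff_map_poly)
  have "eval_XYt \<iota> D x y (1 / s) = (\<Sum>i\<le>degree q. eval_XY \<iota> C x (1 / s) * (coeff q i * y ^ i))"
    unfolding D_def eval_XYt_hom[OF emb] eval_XYt_embed_Xt by (simp add: mult.assoc flip: CA(2))
  also have "\<dots> = eval_XY \<iota> C x (1 / s) * poly q y"
    by (simp add: poly_altdef sum_distrib_left)
  finally have "eval_XYt \<iota> D x y (1 / s) = 0" using assms(3) by simp
  moreover have "degree (coeff D j) < degree N" for j
  proof -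
    have "degree (coeff D j) \<le> degree q"
      unfolding cD by (intro degree_sum_le) (auto intro: order_trans[OF degree_monom_le])
    then show ?thesis using less by simp
  qed
  moreover have "D \<noteq> 0"
  proof
    assume "D = 0"
    have "A (degree q) = 0"
    proof (rule poly_eqI)
      fix j
      have "coeff (coeff D j) (degree q) = coeff (A (degree q)) j"
        unfolding cD by (simp add: coeff_sum)
      then show "coeff (A (degree q)) j = coeff 0 j" using \<open>D = 0\<close> by simp
    qed
    then show False using CA(1) CA(2)[of "degree q"] assms(1) by (simp add: eval_XY_hom[OF emb])
  qed
  ultimately show False using eval_XYt_nonzero by blast
qed

text \<open>This is - s times the kernel at X = u and t = 1/s, as a polynomial in Y.\<close>

definition kernel_Y :: "'k \<Rightarrow> 'k poly" where
  "kernel_Y u = map_poly (\<lambda>q. poly (map_poly \<iota> q) u) N - monom (s * u ^ nat (m_x \<S>)) (nat (m_y \<S>))"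

lemma poly_kernel_Y:
  "poly (kernel_Y u) v = eval_XY \<iota> N u v - s * u ^ nat (m_x \<S>) * v ^ nat (m_y \<S>)"
  unfolding kernel_Y_def eval_XY_def by (simp add: poly_monom)

lemma coeffs_rel_kernel_Y:
  assumes G: "partial_hom G" and "\<And>c. (\<iota> c, \<iota> c) \<in> G" "(s, s) \<in> G" "(a, u) \<in> G"
  shows "coeffs_rel G (kernel_Y a) (kernel_Y u)"
proof -
  have "(poly (map_poly \<iota> q) a, poly (map_poly \<iota> q) u) \<in> G" for q
    using partial_hom_eval_XY[OF G emb assms(2,4,4), of "[:q:]"] by (simp add: eval_XY_hom[OF emb])
  then have "coeffs_rel G (map_poly (\<lambda>q. poly (map_poly \<iota> q) a) N) (map_poly (\<lambda>q. poly (map_poly \<iota> q) u) N)"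
    unfolding coeffs_rel_def by (simp add: coeff_map_poly)
  then show ?thesis
    unfolding kernel_Y_def
    by (intro coeffs_rel_diff coeffs_rel_monom partial_homD(3) partial_hom_power G assms)
qed

text \<open>The upper bound \<open>degree N\<close> on the degree of the specialised kernel meets
  the lower bound of \<open>Kx_degree_bound\<close>. It is nonzero because its coefficient at
  \<open>degree N\<close> is that of \<open>N\<close> evaluated at x.\<close>

lemma min_poly_kernel_Y: "is_min_poly K\<^sub>x y (kernel_Y x)"
proof -
  have "coeffs_rel (Id_on K\<^sub>x) (kernel_Y x) (kernel_Y x)"
    using Kx_generators by (intro coeffs_rel_kernel_Y partial_hom_Kx) auto
  then have c: "coeff (kernel_Y x) i \<in> K\<^sub>x" for i by (simp add: coeffs_rel_Id_on)
  have "coeff (kernel_Y x) (degree N) = eval_XY \<iota> [:lead_coeff N:] x y"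
    unfolding kernel_Y_def using m_y_less_degree_N
    by (simp add: coeff_map_poly eval_XY_hom[OF emb])
  then have "coeff (kernel_Y x) (degree N) \<noteq> 0" using eval_nonzero[of "[:lead_coeff N:]"] N_nonzero by simp
  then have nz: "kernel_Y x \<noteq> 0" by auto
  have "degree (kernel_Y x) \<le> degree N"
    unfolding kernel_Y_def
    using m_y_less_degree_N degree_monom_le[of "s * x ^ nat (m_x \<S>)" "nat (m_y \<S>)"]
    by (intro degree_diff_le map_poly_degree_leq) linarith
  moreover have "poly (kernel_Y x) y = 0"
    unfolding poly_kernel_Y eval_N[OF x_nonzero y_nonzero] by (simp add: mult_ac)
  ultimately show ?thesis
    unfolding is_min_poly_def using nz c Kx_degree_bound order_trans by blast
qed

text \<open>Restricting \<open>G\<close> to k(x) forgets its image of y. The new image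
  \<open>v\<close> is allowed because S(u, v) = s makes it a root of \<open>kernel_Y u\<close>, the
  image of the minimal polynomial of y.\<close>

lemma conjugate_step:
  assumes G: "partial_hom G" and "\<And>c. (\<iota> c, \<iota> c) \<in> G" "(s, s) \<in> G" "(x, u) \<in> G"
    and "u \<noteq> 0" "v \<noteq> 0" "step_value \<S> w \<iota> u v = s"
  shows "\<exists>G'. partial_hom G' \<and> (\<forall>c. (\<iota> c, \<iota> c) \<in> G') \<and> (s, s) \<in> G' \<and> (x, u) \<in> G' \<and> (y, v) \<in> G'"
proof -
  define H where "H = G \<inter> K\<^sub>x \<times> UNIV"
  have H: "partial_hom H" unfolding H_def by (rule partial_hom_restrict[OF G partial_hom_Kx])
  have gens: "\<And>c. (\<iota> c, \<iota> c) \<in> H" "(s, s) \<in> H" "(x, u) \<in> H"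
    using assms Kx_generators unfolding H_def by auto
  have rel: "coeffs_rel H (kernel_Y x) (kernel_Y u)" by (rule coeffs_rel_kernel_Y[OF H gens])
  have "Domain H \<subseteq> K\<^sub>x" unfolding H_def by auto
  \<comment> \<open>The domain of \<open>H\<close> lies in k(x) and contains the coefficients of the
    kernel, so minimality over k(x) passes down to it.\<close>
  then have min: "is_min_poly (Domain H) y (kernel_Y x)"
    using min_poly_kernel_Y coeffs_rel_Domain[OF rel] unfolding is_min_poly_def by blast
  have "poly (kernel_Y u) v = 0"
    unfolding poly_kernel_Y eval_N[OF assms(5,6)] assms(7) by (simp add: mult_ac)
  then have "partial_hom (adjoin H y v)" by (rule partial_hom_adjoin[OF H rel min])
  then show ?thesis
    using adjoin_supset[OF H, of y v] adjoin_generator[OF H, of y v] gens by blast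
qed

end

section \<open>The orbit\<close>

definition swap_XY :: "complex poly poly \<Rightarrow> complex poly poly" where
  "swap_XY P = (\<Sum>j\<le>degree P. \<Sum>i\<le>degree (coeff P j). monom (monom (coeff (coeff P j) i) j) i)"

lemma coeff_swap_XY:
  assumes "j \<le> degree P" "i \<le> degree (coeff P j)"
  shows "coeff (coeff (swap_XY P) i) j = coeff (coeff P j) i"
proof -
  have "coeff (coeff (swap_XY P) i) j =
      (\<Sum>b\<le>degree P. \<Sum>a\<le>degree (coeff P b). coeff (coeff (monom (monom (coeff (coeff P b) a) b) a) i) j)"
    unfolding swap_XY_def coeff_sum ..
  also have "\<dots> = (\<Sum>b\<le>degree P. if b = j then
      (\<Sum>a\<le>degree (coeff P b). if a = i then coeff (coeff P b) a else 0) else 0)"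
  proof (rule sum.cong[OF refl])
    fix b
    show "(\<Sum>a\<le>degree (coeff P b). coeff (coeff (monom (monom (coeff (coeff P b) a) b) a) i) j) =
        (if b = j then (\<Sum>a\<le>degree (coeff P b). if a = i then coeff (coeff P b) a else 0) else 0)"
    proof (cases "b = j")
      case True
      have "coeff (coeff (monom (monom (coeff (coeff P j) a) j) a) i) j = (if a = i then coeff (coeff P j) a else 0)" for a
        by simp
      then show ?thesis using True by simp
    next
      case False
      then show ?thesis by (auto intro!: sum.neutral)
    qed
  qed
  also have "\<dots> = coeff (coeff P j) i"
    using assms by (simp add: sum.delta)
  finally show ?thesis .
qed

lemma eval_swap_XY:
  assumes "field_embedding \<iota>"
  shows "eval_XY \<iota> (swap_XY P) u v = eval_XY \<iota> P v u"
proof -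
  have \<iota>0: "\<iota> 0 = 0" by (rule field_embeddingD(4)[OF assms])
  have "eval_XY \<iota> P v u = (\<Sum>j\<le>degree P. (\<Sum>i\<le>degree (coeff P j). \<iota> (coeff (coeff P j) i) * v ^ i) * u ^ j)"
    unfolding eval_XY_def by (subst poly_map_poly) (auto simp: poly_map_poly[of \<iota>, OF \<iota>0])
  then show ?thesis
    unfolding swap_XY_def eval_XY_hom[OF assms] by (simp add: sum_distrib_left mult_ac)
qed

lemma alg_indep2_swap:
  assumes "field_embedding \<iota>" "alg_indep2 \<iota> x y"
  shows "alg_indep2 \<iota> y x"
  unfolding alg_indep2_def
proof (intro allI impI)
  fix P :: poly_XY assume "P \<noteq> 0"
  then have "coeff (coeff P (degree P)) (degree (lead_coeff P)) \<noteq> 0" by simp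
  then have "swap_XY P \<noteq> 0"
    using coeff_swap_XY[of "degree P" P "degree (lead_coeff P)"] by auto
  then show "eval_XY \<iota> P y x \<noteq> 0"
    using assms eval_swap_XY[OF assms(1), of P x y] unfolding alg_indep2_def by metis
qed

lemma step_value_swap:
  "step_value (prod.swap ` \<S>) (w \<circ> prod.swap) \<iota> v u = step_value \<S> w \<iota> u v"
  unfolding step_value_def
  by (subst sum.reindex) (auto intro!: sum.cong simp: mult_ac)

lemma extremal_exponents_swap:
  "m_x (prod.swap ` \<S>) = m_y \<S>" "M_x (prod.swap ` \<S>) = M_y \<S>"
  "m_y (prod.swap ` \<S>) = m_x \<S>" "M_y (prod.swap ` \<S>) = M_x \<S>"
  unfolding m_x_def M_x_def m_y_def M_y_def by (simp_all add: image_image)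

text \<open>Reflection in the diagonal exchanges the roles of x and y. Interpreting the locale for
  the reflected walk turns each fact about k(x) into one about k(y).\<close>

lemma walk_kernel_swap:
  assumes "walk_kernel \<S> w \<iota> x y"
  shows "walk_kernel (prod.swap ` \<S>) (w \<circ> prod.swap) \<iota> y x"
proof -
  interpret walk_kernel \<S> w \<iota> x y by fact
  show ?thesis
  proof
    show "\<And>a. a \<in> prod.swap ` \<S> \<Longrightarrow> (w \<circ> prod.swap) a \<noteq> 0" using weights by force
  qed (use finite_steps steps_nonempty m_x_pos M_x_pos m_y_pos M_y_pos emb alg_indep2_swap[OF emb indep]
       in \<open>simp_all add: extremal_exponents_swap\<close>)
qed

section \<open>Orbit points as conjugates of (x, y)\<close>

context walk_kernel
begin

interpretation swapped: walk_kernel "prod.swap ` \<S>" "w \<circ> prod.swap" \<iota> y x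
  by (rule walk_kernel_swap[OF walk_kernel_axioms])

definition K\<^sub>y :: "'k set" where "K\<^sub>y = gen_subfield (base_field \<S> w \<iota> x y \<union> {y})"

lemma swapped_Kx: "swapped.K\<^sub>x = K\<^sub>y"
  unfolding swapped.K\<^sub>x_def K\<^sub>y_def base_field_def step_value_swap ..

lemma Ky_generators: "\<iota> c \<in> K\<^sub>y" "s \<in> K\<^sub>y" "y \<in> K\<^sub>y"
  using swapped.Kx_generators unfolding swapped_Kx step_value_swap by auto

lemma partial_hom_Ky: "partial_hom (Id_on K\<^sub>y)"
  using swapped.partial_hom_Kx unfolding swapped_Kx .

lemma algebraic_y: "algebraic_over_subfield K\<^sub>x y"
  using min_poly_kernel_Y unfolding is_min_poly_def algebraic_over_subfield_def by blast

lemma algebraic_x: "algebraic_over_subfield K\<^sub>y x"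
  using swapped.min_poly_kernel_Y unfolding is_min_poly_def algebraic_over_subfield_def swapped_Kx by blast

lemma eval_Yt_nonzero: "B \<noteq> 0 \<Longrightarrow> eval_XY \<iota> B y (1 / s) \<noteq> 0"
  using swapped.eval_Xt_nonzero unfolding step_value_swap .

abbreviation \<O> :: "('k \<times> 'k) set" where "\<O> \<equiv> orbit \<S> w \<iota> x y"

lemma base_point_in_orbit: "(x, y) \<in> \<O>"
  unfolding orbit_def by simp

lemma orbit_step:
  assumes "a \<in> \<O>" "sim_x \<S> w \<iota> a b \<or> sim_y \<S> w \<iota> a b"
  shows "b \<in> \<O>"
  using assms unfolding orbit_def by (auto intro: equivclp_into_equivclp)

text \<open>Both relations are symmetric, so a step of the generated equivalence, taken in either
  direction, changes only the second or only the first coordinate.\<close>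

lemma orbit_induct [consumes 1, case_names base x y]:
  assumes "a \<in> \<O>" and "P x y"
    and "\<And>u v v'. (u, v) \<in> \<O> \<Longrightarrow> P u v \<Longrightarrow> u \<noteq> 0 \<Longrightarrow> v \<noteq> 0 \<Longrightarrow> v' \<noteq> 0 \<Longrightarrow>
           step_value \<S> w \<iota> u v' = step_value \<S> w \<iota> u v \<Longrightarrow> P u v'"
    and "\<And>u v u'. (u, v) \<in> \<O> \<Longrightarrow> P u v \<Longrightarrow> u \<noteq> 0 \<Longrightarrow> v \<noteq> 0 \<Longrightarrow> u' \<noteq> 0 \<Longrightarrow>
           step_value \<S> w \<iota> u' v = step_value \<S> w \<iota> u v \<Longrightarrow> P u' v"
  shows "P (fst a) (snd a)"
  using assms(1) unfolding orbit_def mem_Collect_eq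
proof (induction rule: equivclp_induct)
  case base
  show ?case using assms(2) by simp
next
  case (step b c)
  obtain u v u' v' where bc: "b = (u, v)" "c = (u', v')" by (cases b, cases c)
  have O: "(u, v) \<in> \<O>" using step(1) bc unfolding orbit_def by simp
  have nz: "u \<noteq> 0" "v \<noteq> 0" "u' \<noteq> 0" "v' \<noteq> 0" and eq: "step_value \<S> w \<iota> u' v' = step_value \<S> w \<iota> u v"
    and "u' = u \<or> v' = v"
    using step(2) unfolding sim_x_def sim_y_def bc by auto
  have P: "P u v" using step(3) bc by simp
  from \<open>u' = u \<or> v' = v\<close> show ?case
  proof
    assume "u' = u"
    then show ?thesis using assms(3)[OF O P nz(1,2,4)] eq bc by simp
  next
    assume "v' = v"
    then show ?thesis using assms(4)[OF O P nz(1,2,3)] eq bc by simp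
  qed
qed

lemma orbit_value:
  assumes "a \<in> \<O>"
  shows "fst a \<noteq> 0 \<and> snd a \<noteq> 0 \<and> step_value \<S> w \<iota> (fst a) (snd a) = s"
  using assms by (induction rule: orbit_induct) (auto simp: x_nonzero y_nonzero)

text \<open>A path from (x, y) is followed edge by edge: an x-edge replaces the image of y, a y-edge
  that of x.\<close>

lemma orbit_conjugate:
  assumes "a \<in> \<O>"
  shows "\<exists>G. partial_hom G \<and> (\<forall>c. (\<iota> c, \<iota> c) \<in> G) \<and> (s, s) \<in> G \<and> (x, fst a) \<in> G \<and> (y, snd a) \<in> G"
  using assms
proof (induction rule: orbit_induct)
  case base
  \<comment> \<open>\<open>gen_subfield UNIV\<close> is the whole field; the identity serves for the
    base point.\<close>
  show ?case
    by (rule exI[of _ "Id_on (gen_subfield UNIV)"])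
       (auto intro: partial_hom_Id_on_gen_subfield gen_subfield.base)
next
  case (x u v v')
  have "step_value \<S> w \<iota> u v' = s" using x orbit_value[OF x(1)] by simp
  then show ?case using x conjugate_step[of _ u v'] by blast
next
  case (y u v u')
  then have "step_value \<S> w \<iota> u' v = s" using orbit_value[OF y(1)] by simp
  then show ?case using y swapped.conjugate_step[of _ v u'] unfolding step_value_swap by blast
qed

text \<open>The conjugating map sends D(x, y, 1/s) to the value at the orbit point, and it is
  injective.\<close>

lemma eval_XYt_orbit_nonzero:
  assumes "a \<in> \<O>" "eval_XYt \<iota> D x y (1 / s) \<noteq> 0"
  shows "eval_XYt \<iota> D (fst a) (snd a) (1 / s) \<noteq> 0"
proof
  assume zero: "eval_XYt \<iota> D (fst a) (snd a) (1 / s) = 0"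
  obtain G where G: "partial_hom G" "\<And>c. (\<iota> c, \<iota> c) \<in> G" "(s, s) \<in> G" "(x, fst a) \<in> G" "(y, snd a) \<in> G"
    using orbit_conjugate[OF assms(1)] by blast
  have "(1 / s, 1 / s) \<in> G" by (intro partial_hom_divide G partial_homD(1))
  then have "(eval_XYt \<iota> D x y (1 / s), 0) \<in> G"
    using partial_hom_eval_XYt[OF G(1) emb G(2,4,5)] zero by metis
  then show False using partial_hom_inj[OF G(1)] assms(2) by blast
qed

text \<open>The denominators of \<open>H\<close> and \<open>R\<close> are nonzero at (x, y) by
  regularity, the other two by the algebraic independence of x and s, and of y and s. Conjugacy
  extends this to the orbit, where the kernel is 0 and the term with \<open>R\<close> drops
  out.\<close>

lemma decoupled_value:
  assumes "regular_frac \<S> w H" "admits_galois_decoupling \<S> w H"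
  shows "\<exists>A B C D. \<forall>a\<in>\<O>. value_at \<S> w \<iota> x y H a =
     eval_XY \<iota> A (fst a) (1 / s) / eval_XY \<iota> B (fst a) (1 / s) +
     eval_XY \<iota> C (snd a) (1 / s) / eval_XY \<iota> D (snd a) (1 / s)"
proof -
  obtain F E R where FER: "F \<in> fracs_Xt" "E \<in> fracs_Yt" "regular_frac \<S> w R"
      "H = F + E + to_fract (kernel_poly \<S> w) * R"
    using assms(2) unfolding admits_galois_decoupling_def by blast
  obtain A B :: "complex poly poly" where AB: "F = Fract (map_poly (\<lambda>q. [:q:]) A) (map_poly (\<lambda>q. [:q:]) B)" "B \<noteq> 0"
    using FER(1) unfolding fracs_Xt_def by blast
  obtain C D :: "complex poly poly" where CD: "E = Fract (map_poly (map_poly (\<lambda>c. [:c:])) C) (map_poly (map_poly (\<lambda>c. [:c:])) D)" "D \<noteq> 0"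
    using FER(2) unfolding fracs_Yt_def by blast
  define A' where "A' = (map_poly (\<lambda>q. [:q:]) A :: poly_XYt)"
  define B' where "B' = (map_poly (\<lambda>q. [:q:]) B :: poly_XYt)"
  define C' where "C' = (map_poly (map_poly (\<lambda>c. [:c:])) C :: poly_XYt)"
  define D' where "D' = (map_poly (map_poly (\<lambda>c. [:c:])) D :: poly_XYt)"
  define P Q where "P = fst (quot_of_fract R)" and "Q = snd (quot_of_fract R)"
  define U V where "U = fst (quot_of_fract H)" and "V = snd (quot_of_fract H)"
  let ?K = "kernel_poly \<S> w"
  have evX: "eval_XYt \<iota> (map_poly (\<lambda>q. [:q:]) Z) u v (1 / s) = eval_XY \<iota> Z u (1 / s)" for Z u v
    using eval_XYt_embed_Xt[of \<iota> 0 Z u v "1 / s"] by (simp add: monom_0)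
  have evY: "eval_XYt \<iota> (map_poly (map_poly (\<lambda>c. [:c:])) Z) u v (1 / s) = eval_XY \<iota> Z v (1 / s)" for Z u v
    by (rule eval_XYt_embed_Yt[OF emb])
  have gen: "eval_XYt \<iota> B' x y (1 / s) \<noteq> 0" "eval_XYt \<iota> D' x y (1 / s) \<noteq> 0"
      "eval_XYt \<iota> Q x y (1 / s) \<noteq> 0" "eval_XYt \<iota> V x y (1 / s) \<noteq> 0"
    using eval_Xt_nonzero[OF AB(2)] eval_Yt_nonzero[OF CD(2)] kernel_poly_dvd[of Q] kernel_poly_dvd[of V]
      assms(1) FER(3)
    unfolding regular_frac_def Q_def V_def B'_def D'_def evX evY by auto
  then have nz: "B' \<noteq> 0" "D' \<noteq> 0" "Q \<noteq> 0" "V \<noteq> 0"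
    by (auto simp: eval_XYt_hom[OF emb])
  have H: "H = Fract U V" and R: "R = Fract P Q" unfolding U_def V_def P_def Q_def by simp_all
  have "Fract U V = Fract A' B' + Fract C' D' + Fract ?K 1 * Fract P Q"
    using FER(4) AB(1) CD(1) unfolding H R A'_def B'_def C'_def D'_def to_fract_def by simp
  \<comment> \<open>Values of \<open>H\<close> are defined through its reduced fraction, while the
    numerators and denominators of the other terms come from arbitrary representations. The
    cross-multiplied polynomial identity can be evaluated without comparing representatives.\<close>
  then have "U * (B' * D' * Q) = (((A' * D' + C' * B') * Q + ?K * P * (B' * D'))) * V"
    using nz by (simp add: eq_fract)
  then have key: "eval_XYt \<iota> (U * (B' * D' * Q)) u v (1 / s) =
      eval_XYt \<iota> ((((A' * D' + C' * B') * Q + ?K * P * (B' * D'))) * V) u v (1 / s)" for u v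
    by simp
  have "value_at \<S> w \<iota> x y H a =
     eval_XY \<iota> A (fst a) (1 / s) / eval_XY \<iota> B (fst a) (1 / s) +
     eval_XY \<iota> C (snd a) (1 / s) / eval_XY \<iota> D (snd a) (1 / s)" if a: "a \<in> \<O>" for a
  proof -
    define e where "e Z = eval_XYt \<iota> Z (fst a) (snd a) (1 / s)" for Z
    have n: "e B' \<noteq> 0" "e D' \<noteq> 0" "e Q \<noteq> 0" "e V \<noteq> 0"
      unfolding e_def using eval_XYt_orbit_nonzero[OF a] gen by blast+
    have K: "e ?K = 0" unfolding e_def using orbit_value[OF a] by (intro eval_kernel_poly) auto
    have "e U * (e B' * e D' * e Q) = (e A' * e D' + e C' * e B') * e Q * e V"
      using key[of "fst a" "snd a"] K unfolding eval_XYt_hom[OF emb] e_def by simp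
    then have "e U * (e B' * e D') = (e A' * e D' + e C' * e B') * e V" using n(3) by simp
    then have "e U / e V = e A' / e B' + e C' / e D'"
      using n by (simp add: field_simps)
    then show ?thesis
      unfolding value_at_def eval_frac_def e_def U_def V_def A'_def B'_def C'_def D'_def evX evY .
  qed
  then show ?thesis by blast
qed

end

section \<open>Endomorphisms acting on the orbit\<close>

lemma field_hom_step_value:
  assumes "field_hom \<sigma>" "\<And>c. \<sigma> (\<iota> c) = \<iota> c"
  shows "\<sigma> (step_value \<S> w \<iota> u v) = step_value \<S> w \<iota> (\<sigma> u) (\<sigma> v)"
proof -
  note h = field_homD[OF assms(1)]
  have pow: "\<sigma> (z ^ n) = \<sigma> z ^ n" for z n by (induction n) (simp_all add: h(1,5))
  have "\<sigma> (z powi i) = \<sigma> z powi i" for z i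
    unfolding power_int_def by (simp add: pow h(6))
  then show ?thesis
    unfolding step_value_def by (simp add: field_hom_sum[OF assms(1)] h(5) assms(2) case_prod_beta)
qed

lemma field_hom_eval_XY:
  assumes "field_hom \<sigma>" "field_embedding \<iota>" "\<And>c. \<sigma> (\<iota> c) = \<iota> c"
  shows "\<sigma> (eval_XY \<iota> P u v) = eval_XY \<iota> P (\<sigma> u) (\<sigma> v)"
  using partial_hom_eval_XY[OF assms(1)[unfolded field_hom_def] assms(2), of u "\<sigma> u" v "\<sigma> v" P] assms(3)
  by auto

locale finite_orbit_walk = walk_kernel \<S> w \<iota> x y
  for \<S> w and \<iota> :: "complex \<Rightarrow> 'k::alg_closed_field" and x y +
  assumes algebraic: "algebraic_over_Cxy \<iota> x y" and finite_orbit: "finite \<O>"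
begin

lemma of_nat_nonzero: "n > 0 \<Longrightarrow> (of_nat n :: 'k) \<noteq> 0"
  using field_embeddingD(7)[OF emb, of "of_nat n"] field_embeddingD(8)[OF emb, of n] by simp

text \<open>An endomorphism fixing C commutes with S and so preserves both relations. It maps the
  class of (x, y) into the class of its image, which is again the orbit.\<close>

lemma field_hom_orbit:
  assumes \<sigma>: "field_hom \<sigma>" "\<And>c. \<sigma> (\<iota> c) = \<iota> c" "(\<sigma> x, \<sigma> y) \<in> \<O>" and "a \<in> \<O>"
  shows "(\<sigma> (fst a), \<sigma> (snd a)) \<in> \<O>"
  using assms(4)
proof (induction rule: orbit_induct)
  case base
  show ?case by (rule \<sigma>(3))
next
  case (x u v v')
  then have "sim_x \<S> w \<iota> (\<sigma> u, \<sigma> v) (\<sigma> u, \<sigma> v')"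
    using field_homD(8)[OF \<sigma>(1)] unfolding sim_x_def by (simp flip: field_hom_step_value[OF \<sigma>(1,2)])
  then show ?case using orbit_step x by blast
next
  case (y u v u')
  then have "sim_y \<S> w \<iota> (\<sigma> u, \<sigma> v) (\<sigma> u', \<sigma> v)"
    using field_homD(8)[OF \<sigma>(1)] unfolding sim_y_def by (simp flip: field_hom_step_value[OF \<sigma>(1,2)])
  then show ?case using orbit_step y by blast
qed

text \<open>An injective map of a finite set into itself is a permutation, so applying the
  endomorphism only reorders the sum.\<close>

lemma orbit_sum_fixed:
  assumes \<sigma>: "field_hom \<sigma>" "\<And>c. \<sigma> (\<iota> c) = \<iota> c" "(\<sigma> x, \<sigma> y) \<in> \<O>"
    and h: "\<And>a. \<sigma> (h a) = h (map_prod \<sigma> \<sigma> a)"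
  shows "\<sigma> (\<Sum>a\<in>\<O>. h a) = (\<Sum>a\<in>\<O>. h a)"
proof -
  have inj: "inj_on (map_prod \<sigma> \<sigma>) \<O>"
    using field_homD(9)[OF \<sigma>(1)] by (auto intro: inj_on_subset[OF prod.inj_map])
  have "map_prod \<sigma> \<sigma> ` \<O> \<subseteq> \<O>"
    using field_hom_orbit[OF \<sigma>] by (auto simp: map_prod_def)
  then have im: "map_prod \<sigma> \<sigma> ` \<O> = \<O>" using endo_inj_surj[OF finite_orbit] inj by blast
  have "\<sigma> (\<Sum>a\<in>\<O>. h a) = (\<Sum>a\<in>\<O>. h (map_prod \<sigma> \<sigma> a))"
    by (simp add: field_hom_sum[OF \<sigma>(1)] h)
  also have "\<dots> = (\<Sum>a\<in>map_prod \<sigma> \<sigma> ` \<O>. h a)" using sum.reindex[OF inj, of h] by simp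
  finally show ?thesis using im by simp
qed

text \<open>\<open>L\<close> and \<open>z\<close> stand for k(x) and y, or for k(y) and x.\<close>

lemma orbit_sum_in_subfield:
  assumes L: "partial_hom (Id_on L)" "\<And>c. \<iota> c \<in> L" "s \<in> L" "algebraic_over_subfield L z"
    and xy: "{x, y} \<subseteq> insert z L"
    and \<sigma>: "\<And>\<sigma>. field_hom \<sigma> \<Longrightarrow> (\<And>a. a \<in> L \<Longrightarrow> \<sigma> a = a) \<Longrightarrow> (\<sigma> x, \<sigma> y) \<in> \<O>"
    and h: "\<And>\<sigma> a. field_hom \<sigma> \<Longrightarrow> (\<And>c. \<sigma> (\<iota> c) = \<iota> c) \<Longrightarrow> \<sigma> s = s \<Longrightarrow> \<sigma> (h a) = h (map_prod \<sigma> \<sigma> a)"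
  shows "(\<Sum>a\<in>\<O>. h a) \<in> L"
proof (rule fixed_field[OF L(1,4)])
  fix b
  have "gen_subfield (range \<iota> \<union> {x, y}) \<subseteq> gen_subfield (insert z L)"
    by (rule gen_subfield_subset[OF partial_hom_Id_on_gen_subfield])
       (use L(2) xy in \<open>auto intro!: gen_subfield.base\<close>)
  then show "algebraic_over_subfield (gen_subfield (insert z L)) b"
    using algebraic algebraic_over_subfield_mono unfolding algebraic_over_Cxy_def by blast
next
  fix \<sigma> :: "'k \<Rightarrow> 'k" assume "field_hom \<sigma>" "\<And>a. a \<in> L \<Longrightarrow> \<sigma> a = a"
  then show "\<sigma> (\<Sum>a\<in>\<O>. h a) = (\<Sum>a\<in>\<O>. h a)"
    using L \<sigma> h by (intro orbit_sum_fixed) auto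
qed (rule of_nat_nonzero)

lemma orbit_sum_in_Kx_Ky:
  assumes h: "\<And>\<sigma> a. field_hom \<sigma> \<Longrightarrow> (\<And>c. \<sigma> (\<iota> c) = \<iota> c) \<Longrightarrow> \<sigma> s = s \<Longrightarrow> \<sigma> (h a) = h (map_prod \<sigma> \<sigma> a)"
  shows "(\<Sum>a\<in>\<O>. h a) \<in> K\<^sub>x" "(\<Sum>a\<in>\<O>. h a) \<in> K\<^sub>y"
proof -
  have nz: "\<sigma> x \<noteq> 0" "\<sigma> y \<noteq> 0" if "field_hom \<sigma>" for \<sigma>
    using field_homD(8)[OF that, of x] field_homD(8)[OF that, of y] x_nonzero y_nonzero by simp_all
  show "(\<Sum>a\<in>\<O>. h a) \<in> K\<^sub>x"
  proof (rule orbit_sum_in_subfield[OF partial_hom_Kx Kx_generators(1,2) algebraic_y _ _ h])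
    fix \<sigma> :: "'k \<Rightarrow> 'k" assume \<sigma>: "field_hom \<sigma>" "\<And>a. a \<in> K\<^sub>x \<Longrightarrow> \<sigma> a = a"
    \<comment> \<open>The map fixes x and s, so it keeps the first coordinate and the step value of
      (x, y).\<close>
    have "sim_x \<S> w \<iota> (x, y) (\<sigma> x, \<sigma> y)"
      using \<sigma> nz[OF \<sigma>(1)] Kx_generators x_nonzero y_nonzero field_hom_step_value[OF \<sigma>(1), of \<iota> \<S> w x y]
      unfolding sim_x_def by simp
    then show "(\<sigma> x, \<sigma> y) \<in> \<O>" using orbit_step base_point_in_orbit by blast
  qed (use Kx_generators in auto)
  show "(\<Sum>a\<in>\<O>. h a) \<in> K\<^sub>y"
  proof (rule orbit_sum_in_subfield[OF partial_hom_Ky Ky_generators(1,2) algebraic_x _ _ h])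
    fix \<sigma> :: "'k \<Rightarrow> 'k" assume \<sigma>: "field_hom \<sigma>" "\<And>a. a \<in> K\<^sub>y \<Longrightarrow> \<sigma> a = a"
    have "sim_y \<S> w \<iota> (x, y) (\<sigma> x, \<sigma> y)"
      using \<sigma> nz[OF \<sigma>(1)] Ky_generators x_nonzero y_nonzero field_hom_step_value[OF \<sigma>(1), of \<iota> \<S> w x y]
      unfolding sim_y_def by simp
    then show "(\<sigma> x, \<sigma> y) \<in> \<O>" using orbit_step base_point_in_orbit by blast
  qed (use Ky_generators in auto)
qed

end

section \<open>Evaluation of chains\<close>

text \<open>\<open>value_chain\<close> with an arbitrary function in place of the evaluation of
  \<open>H\<close>, so that the contributions of the two coordinates can be evaluated
  separately.\<close>

definition chain_eval :: "(complex \<Rightarrow> 'k::field) \<Rightarrow> ('a \<Rightarrow> 'k) \<Rightarrow> ('a \<Rightarrow>\<^sub>0 complex) \<Rightarrow> 'k" where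
  "chain_eval \<iota> \<phi> \<beta> = (\<Sum>a\<in>Poly_Mapping.keys \<beta>. \<iota> (Poly_Mapping.lookup \<beta> a) * \<phi> a)"

lemma lookup_chain_scale: "Poly_Mapping.lookup (chain_scale z c) a = z * Poly_Mapping.lookup c a"
  unfolding chain_scale_def by (simp add: map.rep_eq when_def)

lemma chain_eval_superset:
  assumes "field_embedding \<iota>" "finite A" "Poly_Mapping.keys \<beta> \<subseteq> A"
  shows "chain_eval \<iota> \<phi> \<beta> = (\<Sum>a\<in>A. \<iota> (Poly_Mapping.lookup \<beta> a) * \<phi> a)"
  unfolding chain_eval_def
  by (rule sum.mono_neutral_left)
     (use assms field_embeddingD(4)[OF assms(1)] in \<open>auto simp: in_keys_iff\<close>)

lemma chain_eval_add:
  assumes "field_embedding \<iota>"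
  shows "chain_eval \<iota> \<phi> (\<beta> + \<gamma>) = chain_eval \<iota> \<phi> \<beta> + chain_eval \<iota> \<phi> \<gamma>"
proof -
  let ?A = "Poly_Mapping.keys \<beta> \<union> Poly_Mapping.keys \<gamma>"
  have "Poly_Mapping.keys (\<beta> + \<gamma>) \<subseteq> ?A" by (rule keys_add)
  then show ?thesis
    by (simp add: chain_eval_superset[OF assms, of ?A] lookup_add field_embeddingD(2)[OF assms]
        distrib_right sum.distrib)
qed

lemma chain_eval_scale:
  assumes "field_embedding \<iota>"
  shows "chain_eval \<iota> \<phi> (chain_scale z \<beta>) = \<iota> z * chain_eval \<iota> \<phi> \<beta>"
proof -
  have "Poly_Mapping.keys (chain_scale z \<beta>) \<subseteq> Poly_Mapping.keys \<beta>"
    by (auto simp: in_keys_iff lookup_chain_scale)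
  then show ?thesis
    by (simp add: chain_eval_superset[OF assms, of "Poly_Mapping.keys \<beta>"] lookup_chain_scale
        field_embeddingD(3)[OF assms] sum_distrib_left mult.assoc)
qed

lemma chain_eval_diff:
  assumes "field_embedding \<iota>"
  shows "chain_eval \<iota> \<phi> (\<beta> - \<gamma>) = chain_eval \<iota> \<phi> \<beta> - chain_eval \<iota> \<phi> \<gamma>"
  using chain_eval_add[OF assms, of \<phi> "\<beta> - \<gamma>" \<gamma>] by simp

lemma chain_eval_sum:
  assumes "field_embedding \<iota>"
  shows "chain_eval \<iota> \<phi> (\<Sum>i\<in>I. \<beta> i) = (\<Sum>i\<in>I. chain_eval \<iota> \<phi> (\<beta> i))"
  by (induction I rule: infinite_finite_induct)
     (simp_all add: chain_eval_add[OF assms], simp_all add: chain_eval_def)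

lemma chain_eval_vertex:
  assumes "field_embedding \<iota>"
  shows "chain_eval \<iota> \<phi> (vertex_chain a) = \<phi> a"
  unfolding chain_eval_def vertex_chain_def by (simp add: field_embeddingD(1)[OF assms])

lemma chain_eval_boundary_on:
  assumes "field_embedding \<iota>"
  shows "chain_eval \<iota> \<phi> (boundary_on B c) =
    (\<Sum>e\<in>Poly_Mapping.keys c \<inter> B. \<iota> (Poly_Mapping.lookup c e) * (\<phi> (snd e) - \<phi> (fst e)))"
  unfolding boundary_on_def chain_eval_sum[OF assms]
  by (intro sum.cong refl)
     (auto simp: chain_eval_scale[OF assms] chain_eval_diff[OF assms] chain_eval_vertex[OF assms])

text \<open>With \<open>p\<close> one of the two projections, this is how the conditions on the
  boundaries are used: the sum is grouped by fibres, on each of which the function is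
  constant.\<close>

lemma chain_eval_fibre_zero:
  fixes \<beta> :: "'a \<Rightarrow>\<^sub>0 complex"
  assumes "field_embedding \<iota>"
    and "\<And>u. (\<Sum>a\<in>{a \<in> Poly_Mapping.keys \<beta>. p a = u}. Poly_Mapping.lookup \<beta> a) = 0"
  shows "chain_eval \<iota> (\<lambda>a. f (p a)) \<beta> = 0"
proof -
  have \<iota>_sum: "\<iota> (\<Sum>a\<in>A. g a) = (\<Sum>a\<in>A. \<iota> (g a))" for A and g :: "'a \<Rightarrow> complex"
    by (induction A rule: infinite_finite_induct) (simp_all add: field_embeddingD[OF assms(1)])
  have "chain_eval \<iota> (\<lambda>a. f (p a)) \<beta> = (\<Sum>u\<in>p ` Poly_Mapping.keys \<beta>.
      \<Sum>a\<in>{a \<in> Poly_Mapping.keys \<beta>. p a = u}. \<iota> (Poly_Mapping.lookup \<beta> a) * f (p a))"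
    unfolding chain_eval_def by (rule sum.image_gen) simp
  also have "\<dots> = (\<Sum>u\<in>p ` Poly_Mapping.keys \<beta>.
      \<iota> (\<Sum>a\<in>{a \<in> Poly_Mapping.keys \<beta>. p a = u}. Poly_Mapping.lookup \<beta> a) * f u)"
    unfolding \<iota>_sum sum_distrib_right by (intro sum.cong refl) auto
  also have "\<dots> = 0" using assms(2) by (simp add: field_embeddingD(4)[OF assms(1)])
  finally show ?thesis .
qed

lemma chains_on_iff: "c \<in> chains_on A \<longleftrightarrow> (\<forall>a. a \<notin> A \<longrightarrow> Poly_Mapping.lookup c a = 0)"
  unfolding chains_on_def by (auto simp: in_keys_iff)

lemma chains_on_closed:
  shows "\<beta> \<in> chains_on A \<Longrightarrow> \<gamma> \<in> chains_on A \<Longrightarrow> \<beta> + \<gamma> \<in> chains_on A"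
    and "\<beta> \<in> chains_on A \<Longrightarrow> chain_scale z \<beta> \<in> chains_on A"
    and "(\<And>i. i \<in> I \<Longrightarrow> F i \<in> chains_on A) \<Longrightarrow> (\<Sum>i\<in>I. F i) \<in> chains_on A"
    and "a \<in> A \<Longrightarrow> vertex_chain a \<in> chains_on A"
    and "B \<subseteq> A \<times> A \<Longrightarrow> boundary_on B c \<in> chains_on A"
proof -
  show "\<beta> \<in> chains_on A \<Longrightarrow> \<gamma> \<in> chains_on A \<Longrightarrow> \<beta> + \<gamma> \<in> chains_on A"
    by (auto simp: chains_on_iff lookup_add)
  show "\<beta> \<in> chains_on A \<Longrightarrow> chain_scale z \<beta> \<in> chains_on A"
    by (auto simp: chains_on_iff lookup_chain_scale)
  show "(\<And>i. i \<in> I \<Longrightarrow> F i \<in> chains_on A) \<Longrightarrow> (\<Sum>i\<in>I. F i) \<in> chains_on A"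
    by (auto simp: chains_on_iff lookup_sum)
  show "a \<in> A \<Longrightarrow> vertex_chain a \<in> chains_on A"
    by (auto simp: chains_on_iff vertex_chain_def lookup_single when_def)
  assume "B \<subseteq> A \<times> A"
  then show "boundary_on B c \<in> chains_on A"
    unfolding chains_on_iff boundary_on_def lookup_sum
    by (auto intro!: sum.neutral simp: lookup_chain_scale lookup_minus vertex_chain_def lookup_single when_def)
qed

section \<open>Boundaries evaluated on decoupled functions\<close>

context walk_kernel
begin

lemma x_edgesD:
  assumes "e \<in> x_edges \<S> w \<iota> x y" shows "fst (snd e) = fst (fst e)" "fst e \<in> \<O>" "snd e \<in> \<O>"
  using assms unfolding x_edges_def sim_x_def by auto

lemma y_edgesD:
  assumes "e \<in> y_edges \<S> w \<iota> x y" shows "snd (snd e) = snd (fst e)" "fst e \<in> \<O>" "snd e \<in> \<O>"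
  using assms unfolding y_edges_def sim_y_def by auto

text \<open>Along y-arcs the second coordinate is constant, so \<open>g\<close> contributes nothing.
  Along x-arcs the first coordinate is constant, so for \<open>f\<close> the partial boundary may be
  replaced by the full one, to which the fibre condition applies.\<close>

lemma chain_eval_boundary_y:
  assumes \<phi>: "\<And>a. a \<in> \<O> \<Longrightarrow> \<phi> a = f (fst a) + g (snd a)"
    and c: "Poly_Mapping.keys c \<subseteq> x_edges \<S> w \<iota> x y \<union> y_edges \<S> w \<iota> x y"
    and eps: "eps_x_zero (boundary c + vertex_chain (x, y) - vertex_chain a)"
  shows "chain_eval \<iota> \<phi> (boundary_y \<S> w \<iota> x y c) = f (fst a) - f x"
proof -
  let ?f = "\<lambda>a. f (fst a)"
  have "chain_eval \<iota> \<phi> (boundary_y \<S> w \<iota> x y c) = chain_eval \<iota> ?f (boundary_y \<S> w \<iota> x y c)"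
    unfolding boundary_y_def chain_eval_boundary_on[OF emb]
    by (intro sum.cong refl) (use y_edgesD in \<open>simp add: \<phi>\<close>)
  also have "\<dots> = chain_eval \<iota> ?f (boundary c)"
    unfolding boundary_y_def boundary_def chain_eval_boundary_on[OF emb]
    by (rule sum.mono_neutral_left) (use c x_edgesD(1) in fastforce)+
  also have "\<dots> = f (fst a) - f x"
    using chain_eval_fibre_zero[OF emb, of "boundary c + vertex_chain (x, y) - vertex_chain a" fst f] eps
    unfolding eps_x_zero_def
    by (simp add: chain_eval_add[OF emb] chain_eval_diff[OF emb] chain_eval_vertex[OF emb] algebra_simps)
  finally show ?thesis .
qed

lemma chain_eval_boundary_x:
  assumes \<phi>: "\<And>a. a \<in> \<O> \<Longrightarrow> \<phi> a = f (fst a) + g (snd a)"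
    and c: "Poly_Mapping.keys c \<subseteq> x_edges \<S> w \<iota> x y \<union> y_edges \<S> w \<iota> x y"
    and eps: "eps_y_zero (boundary c + vertex_chain (x, y) - vertex_chain a)"
  shows "chain_eval \<iota> \<phi> (boundary_x \<S> w \<iota> x y c) = g (snd a) - g y"
proof -
  let ?g = "\<lambda>a. g (snd a)"
  have "chain_eval \<iota> \<phi> (boundary_x \<S> w \<iota> x y c) = chain_eval \<iota> ?g (boundary_x \<S> w \<iota> x y c)"
    unfolding boundary_x_def chain_eval_boundary_on[OF emb]
    by (intro sum.cong refl) (use x_edgesD in \<open>simp add: \<phi>\<close>)
  also have "\<dots> = chain_eval \<iota> ?g (boundary c)"
    unfolding boundary_x_def boundary_def chain_eval_boundary_on[OF emb]
    by (rule sum.mono_neutral_left) (use c y_edgesD(1) in fastforce)+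
  also have "\<dots> = g (snd a) - g y"
    using chain_eval_fibre_zero[OF emb, of "boundary c + vertex_chain (x, y) - vertex_chain a" snd g] eps
    unfolding eps_y_zero_def
    by (simp add: chain_eval_add[OF emb] chain_eval_diff[OF emb] chain_eval_vertex[OF emb] algebra_simps)
  finally show ?thesis .
qed

end

context finite_orbit_walk
begin

lemma pseudo_decoupling:
  assumes edges: "Arcs \<subseteq> x_edges \<S> w \<iota> x y \<union> y_edges \<S> w \<iota> x y"
    and px: "\<And>a. a \<in> \<O> \<Longrightarrow> px a \<in> chains_on Arcs" and py: "\<And>a. a \<in> \<O> \<Longrightarrow> py a \<in> chains_on Arcs"
    and eps_x: "\<And>a. a \<in> \<O> \<Longrightarrow> eps_x_zero (boundary (px a) + vertex_chain (x, y) - vertex_chain a)"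
    and eps_y: "\<And>a. a \<in> \<O> \<Longrightarrow> eps_y_zero (boundary (py a) + vertex_chain (x, y) - vertex_chain a)"
  shows "is_pseudo_decoupling \<S> w \<iota> x y
           (omega \<S> w \<iota> x y + gamma_x \<S> w \<iota> x y px) (gamma_y \<S> w \<iota> x y py)"
  unfolding is_pseudo_decoupling_def
proof (intro conjI allI impI; (elim conjE)?)
  have sub: "x_edges \<S> w \<iota> x y \<subseteq> \<O> \<times> \<O>" "y_edges \<S> w \<iota> x y \<subseteq> \<O> \<times> \<O>"
    unfolding x_edges_def y_edges_def by auto
  show "omega \<S> w \<iota> x y + gamma_x \<S> w \<iota> x y px \<in> chains_on \<O>" "gamma_y \<S> w \<iota> x y py \<in> chains_on \<O>"
    unfolding omega_def gamma_x_def gamma_y_def boundary_x_def boundary_y_def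
    by (intro chains_on_closed sub; assumption)+
next
  fix H assume H: "regular_frac \<S> w H" "admits_galois_decoupling \<S> w H"
  let ?gx = "omega \<S> w \<iota> x y + gamma_x \<S> w \<iota> x y px" and ?gy = "gamma_y \<S> w \<iota> x y py"
  obtain A B C D where ABCD: "\<And>a. a \<in> \<O> \<Longrightarrow> value_at \<S> w \<iota> x y H a =
     eval_XY \<iota> A (fst a) (1 / s) / eval_XY \<iota> B (fst a) (1 / s) +
     eval_XY \<iota> C (snd a) (1 / s) / eval_XY \<iota> D (snd a) (1 / s)"
    using decoupled_value[OF H] by blast
  define f where "f u = eval_XY \<iota> A u (1 / s) / eval_XY \<iota> B u (1 / s)" for u
  define g where "g v = eval_XY \<iota> C v (1 / s) / eval_XY \<iota> D v (1 / s)" for v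
  define \<phi> where "\<phi> = value_at \<S> w \<iota> x y H"
  define n where "n = card \<O>"
  have \<phi>: "\<phi> a = f (fst a) + g (snd a)" if "a \<in> \<O>" for a
    using ABCD[OF that] unfolding \<phi>_def f_def g_def .
  define E where "E = (\<Sum>a\<in>\<O>. g (snd a)) / of_nat n"
  have "n > 0" unfolding n_def using finite_orbit base_point_in_orbit by (auto simp: card_gt_0_iff)
  then have n0: "(of_nat n :: 'k) \<noteq> 0" by (rule of_nat_nonzero)
  have \<iota>n: "\<iota> (1 / of_nat n) = 1 / of_nat n" "\<iota> (- 1 / of_nat n) = - 1 / of_nat n"
    using field_embedding_inverse[OF emb, of "of_nat n"] field_embeddingD(5,8)[OF emb]
    by (simp_all add: divide_inverse)
  have keys: "Poly_Mapping.keys (px a) \<subseteq> x_edges \<S> w \<iota> x y \<union> y_edges \<S> w \<iota> x y"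
    "Poly_Mapping.keys (py a) \<subseteq> x_edges \<S> w \<iota> x y \<union> y_edges \<S> w \<iota> x y" if "a \<in> \<O>" for a
    using px[OF that] py[OF that] edges unfolding chains_on_def by auto
  have om: "chain_eval \<iota> \<phi> (omega \<S> w \<iota> x y) = (\<Sum>a\<in>\<O>. f (fst a)) / of_nat n + E"
    unfolding omega_def chain_eval_scale[OF emb] chain_eval_sum[OF emb] chain_eval_vertex[OF emb] n_def[symmetric] \<iota>n E_def
    by (simp add: \<phi> sum.distrib add_divide_distrib)
  have "chain_eval \<iota> \<phi> (gamma_x \<S> w \<iota> x y px) = - 1 / of_nat n * (\<Sum>a\<in>\<O>. f (fst a) - f x)"
    unfolding gamma_x_def chain_eval_scale[OF emb] chain_eval_sum[OF emb] n_def[symmetric] \<iota>n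
    by (intro arg_cong2[of _ _ _ _ "(*)"] refl sum.cong chain_eval_boundary_y[where g = g] \<phi> keys(1) eps_x)
  \<comment> \<open>The orbit average of \<open>f\<close> subtracted here cancels the one contained
    in the value of \<open>omega\<close>.\<close>
  also have "\<dots> = f x - (\<Sum>a\<in>\<O>. f (fst a)) / of_nat n"
    using n0 by (simp add: sum_subtractf n_def[symmetric] field_simps)
  finally have gx: "chain_eval \<iota> \<phi> ?gx = f x + E"
    unfolding chain_eval_add[OF emb] om by simp
  have "chain_eval \<iota> \<phi> (gamma_y \<S> w \<iota> x y py) = - 1 / of_nat n * (\<Sum>a\<in>\<O>. g (snd a) - g y)"
    unfolding gamma_y_def chain_eval_scale[OF emb] chain_eval_sum[OF emb] n_def[symmetric] \<iota>n
    by (intro arg_cong2[of _ _ _ _ "(*)"] refl sum.cong chain_eval_boundary_x[where f = f] \<phi> keys(2) eps_y)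
  also have "\<dots> = g y - E"
    unfolding E_def using n0 by (simp add: sum_subtractf n_def[symmetric] field_simps)
  finally have gy: "chain_eval \<iota> \<phi> ?gy = g y - E" .
  have vc: "value_chain \<S> w \<iota> x y H = chain_eval \<iota> \<phi>"
    unfolding value_chain_def chain_eval_def \<phi>_def by blast
  have in_L: "eval_XY \<iota> P z (1 / s) / eval_XY \<iota> Q z (1 / s) \<in> L"
    if "partial_hom (Id_on L)" "\<And>c. \<iota> c \<in> L" "s \<in> L" "z \<in> L" for L z P Q
  proof -
    have "(1 / s, 1 / s) \<in> Id_on L"
      using that by (intro partial_hom_divide partial_homD(1)) auto
    then have "(eval_XY \<iota> P z (1 / s), eval_XY \<iota> P z (1 / s)) \<in> Id_on L" for P
      using that by (intro partial_hom_eval_XY emb) auto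
    then show ?thesis using partial_hom_divide[OF that(1)] by blast
  qed
  \<comment> \<open>\<open>g\<close> is a quotient of polynomials in v and 1/s over C, and the map
    fixes C and s, so only the argument moves.\<close>
  have equiv: "\<sigma> (g (snd a)) = g (snd (map_prod \<sigma> \<sigma> a))"
    if "field_hom \<sigma>" "\<And>c. \<sigma> (\<iota> c) = \<iota> c" "\<sigma> s = s" for \<sigma> a
    unfolding g_def field_homD(7)[OF that(1)] field_hom_eval_XY[OF that(1) emb that(2)] that(3) field_homD(1)[OF that(1)] 
    by (cases a) simp
  have E: "E \<in> K\<^sub>x" "E \<in> K\<^sub>y"
  proof -
    have nat: "of_nat n \<in> K\<^sub>x" "of_nat n \<in> K\<^sub>y"
      using Kx_generators(1)[of "of_nat n"] Ky_generators(1)[of "of_nat n"] by (simp_all add: field_embeddingD(8)[OF emb])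
    show "E \<in> K\<^sub>x" "E \<in> K\<^sub>y"
      unfolding E_def
      using partial_hom_divide[OF partial_hom_Kx Id_onI Id_onI] partial_hom_divide[OF partial_hom_Ky Id_onI Id_onI]
        nat orbit_sum_in_Kx_Ky[of "\<lambda>a. g (snd a)", OF equiv] by blast+
  qed
  show "value_at \<S> w \<iota> x y H (x, y) = value_chain \<S> w \<iota> x y H ?gx + value_chain \<S> w \<iota> x y H ?gy"
    unfolding vc gx gy using \<phi>[OF base_point_in_orbit] by (simp add: \<phi>_def)
  have "f x \<in> K\<^sub>x" unfolding f_def by (rule in_L[OF partial_hom_Kx Kx_generators])
  then have "f x + E \<in> K\<^sub>x" using partial_hom_add[OF partial_hom_Kx Id_onI Id_onI] E by blast
  then show "value_chain \<S> w \<iota> x y H ?gx \<in> gen_subfield (base_field \<S> w \<iota> x y \<union> {x})"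
    unfolding vc gx K\<^sub>x_def .
  have "g y \<in> K\<^sub>y" unfolding g_def by (rule in_L[OF partial_hom_Ky Ky_generators])
  then have "g y - E \<in> K\<^sub>y" using partial_homD(2)[OF partial_hom_Ky Id_onI Id_onI] E by blast
  then show "value_chain \<S> w \<iota> x y H ?gy \<in> gen_subfield (base_field \<S> w \<iota> x y \<union> {y})"
    unfolding vc gy K\<^sub>y_def .
qed

end

theorem mainTheorem8:
  fixes \<S> :: "(int \<times> int) set"
    and w :: "int \<times> int \<Rightarrow> complex"
    and \<iota> :: "complex \<Rightarrow> 'k::alg_closed_field"
    and x y :: 'k
    and Arcs :: "(('k \<times> 'k) \<times> ('k \<times> 'k)) set"
    and px py :: "'k \<times> 'k \<Rightarrow> ((('k \<times> 'k) \<times> ('k \<times> 'k)) \<Rightarrow>\<^sub>0 complex)"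
  assumes "finite \<S>" and "\<S> \<noteq> {}"
    and "\<And>s. s \<in> \<S> \<Longrightarrow> w s \<noteq> 0"
    and "m_x \<S> > 0" and "M_x \<S> > 0" and "m_y \<S> > 0" and "M_y \<S> > 0"
    and "field_embedding \<iota>"
    and "alg_indep2 \<iota> x y"
    and "algebraic_over_Cxy \<iota> x y"
    and "finite (orbit \<S> w \<iota> x y)"
    and "is_orientation \<S> w \<iota> x y Arcs"
    and "\<And>a. a \<in> orbit \<S> w \<iota> x y \<Longrightarrow> px a \<in> chains_on Arcs"
    and "\<And>a. a \<in> orbit \<S> w \<iota> x y \<Longrightarrow> py a \<in> chains_on Arcs"
    and "\<And>a. a \<in> orbit \<S> w \<iota> x y \<Longrightarrow>
           eps_x_zero (boundary (px a) + vertex_chain (x, y) - vertex_chain a)"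
    and "\<And>a. a \<in> orbit \<S> w \<iota> x y \<Longrightarrow>
           eps_y_zero (boundary (py a) + vertex_chain (x, y) - vertex_chain a)"
  shows "is_pseudo_decoupling \<S> w \<iota> x y
           (omega \<S> w \<iota> x y + gamma_x \<S> w \<iota> x y px) (gamma_y \<S> w \<iota> x y py)"
proof -
  interpret finite_orbit_walk \<S> w \<iota> x y
    by unfold_locales (fact assms)+
  show ?thesis
    using assms(12) by (intro pseudo_decoupling[of Arcs] assms) (simp add: is_orientation_def)
qed

end
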